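(* Let $n,t\in\mathbf{N}$, $d\ge1$, let $q$ be a power of an odd prime, and let $A\subseteq\mathbf{F}_q^d$ with $|A|=\alpha q^d$ where $\alpha \geq 12 n^2 q^{t-\frac{d+1}{2}}$. Let $\mathcal{G}=(V,E)$ be any distance graph with vertex set $V=\{v_1,\dots,v_n\}$, $m$ edges, and maximum vertex degree $t$. Then the number of $n$-tuples $(x_1,\dots,x_n)$ of pairwise distinct points of $A$ such that $|x_i-x_j|^2=\lambda_{e_{i,j}}$ whenever $v_i$ and $v_j$ are adjacent is at least $\tfrac12 |A|^n q^{-m}$. In particular, $A$ contains at least $\tfrac12|A|^n q^{-m}$ (ordered) isometric copies of $\mathcal{G}$.
   Context: $\mathbf{F}_q$ is the finite field with $q$ elements (odd characteristic). For $v\in\mathbf{F}_q^d$, $|v|^2 := \sum_{j=1}^d v_j^2$. A distance graph is a finite simple graph $\mathcal{G}=(V,E)$ together with a nonzero length $\lambda_e\in\mathbf{F}_q^*$ for each edge $e$; the edge joining $v_i$ and $v_j$ is denoted $e_{i,j}$. An isometric copy of $\mathcal{G}$ is a set $X\subseteq\mathbf{F}_q^d$ with a bijection $\varphi:V\to X$ such that $|\varphi(v)-\varphi(w)|^2=\lambda_e$ whenever $v,w$ are joined by the edge $e$; an ordered isometric copy is the tuple $(\varphi(v_1),\dots,\varphi(v_n))$. *)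

theory Defs
  imports "HOL-Analysis.Analysis"
begin

definition sqnorm :: "'a::comm_ring_1 ^ 'd \<Rightarrow> 'a" where
  "sqnorm v = (\<Sum>j\<in>UNIV. (v $ j) ^ 2)"

definition gdeg :: "nat \<Rightarrow> (nat \<Rightarrow> nat \<Rightarrow> bool) \<Rightarrow> nat \<Rightarrow> nat" where
  "gdeg n adj i = card {j. j < n \<and> adj i j}"

definition gedges :: "nat \<Rightarrow> (nat \<Rightarrow> nat \<Rightarrow> bool) \<Rightarrow> nat set set" where
  "gedges n adj = {{i, j} | i j. i < n \<and> j < n \<and> adj i j}"

end

theory Submission
  imports "HOL-Algebra.Algebraic_Closure_Type" "HOL-Number_Theory.Cong" Defs
    "HOL-Computational_Algebra.Computational_Algebra"
begin

text \<open>
  For a non-zero length \<open>l\<close> the kernel \<open>q * [|x - y|^2 = l] - 1\<close> has operator norm at most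
  \<open>2 * q^((d+1)/2)\<close>: its Fourier coefficients are Gauss sums times Kloosterman sums (even \<open>d\<close>) or Salie
  sums (odd \<open>d\<close>). Adding the edges of the graph one at a time, Cauchy-Schwarz bounds the error of each
  edge by counts for smaller graphs, and tuples with a coincidence are rare for the same reason.

  Salie sums are evaluated in closed form. For a Kloosterman sum \<open>K\<close> over a field \<open>S\<close> of \<open>Q\<close> elements,
  counting roots of quadratics shows that the corresponding sum over the quadratic extension is
  \<open>2 * Q - K^2\<close>. A bound \<open>C * sqrt Q\<close> with \<open>C\<close> independent of the height in the resulting tower therefore
  improves itself to Weil's bound \<open>2 * sqrt Q\<close>; such a bound follows from Stepanov's method, applied
  to \<open>w^2 = (y^q - y + t)^2 - 4 * a\<close>.
\<close>

section \<open>Stepanov's method\<close>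

text \<open>The obstacle is even dimension: a trivial bound for the Kloosterman sums would lose a
  factor of order sqrt q in the operator norm, and with it the threshold, so square-root
  cancellation has to be proved. Stepanov's method is run only over fields with \<open>P\<close>^2
  elements where \<open>P\<close> is large compared with the degree of the polynomial, and the base
  field need not be of this kind. The tower removes the restriction: its higher levels have square
  size and grow, while the polynomial keeps its degree 2 q, so estimates that hold only at high
  levels are enough.

  The constant 12 is a budget. Removing one edge changes the normalised count by at most 1/(3 n^2),
  there are at most n^2/2 edges, and each of the at most n^2 possible coincidences costs at most
  1/(6 n^2). At least 5/6 - 1/6 of the expected count survives.\<close>

lemma underdetermined_system:
  fixes M :: "'j \<Rightarrow> nat \<Rightarrow> 'k::field"
  assumes "finite J" "N < card J"
  shows "\<exists>d. (\<exists>j\<in>J. d j \<noteq> 0) \<and> (\<forall>i<N. (\<Sum>j\<in>J. d j * M j i) = 0)"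
  using assms
proof (induction N arbitrary: J M)
  case 0
  then obtain j where "j \<in> J" by fastforce
  then show ?case by (intro exI[of _ "\<lambda>_. 1"]) auto
next
  case (Suc N)
  show ?case
  proof (cases "\<forall>j\<in>J. M j N = 0")
    case True
    with Suc.IH[of J M] Suc.prems obtain d where
      "\<exists>j\<in>J. d j \<noteq> 0" "\<forall>i<N. (\<Sum>j\<in>J. d j * M j i) = 0" by force
    with True show ?thesis by (intro exI[of _ d]) (auto simp: less_Suc_eq)
  next
    case False
    then obtain j0 where j0: "j0 \<in> J" "M j0 N \<noteq> 0" by auto
    define c where "c j = M j N / M j0 N" for j
    define J' where "J' = J - {j0}"
    have J: "J = insert j0 J'" "j0 \<notin> J'" "finite J'" using j0 Suc.prems by (auto simp: J'_def)
    with Suc.prems have "N < card J'" by auto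
    with Suc.IH[of J' "\<lambda>j i. M j i - c j * M j0 i"] J obtain d where
      d: "\<exists>j\<in>J'. d j \<noteq> 0" "\<And>i. i < N \<Longrightarrow> (\<Sum>j\<in>J'. d j * (M j i - c j * M j0 i)) = 0" by blast
    \<comment> \<open>The value at the pivot \<open>j0\<close> is chosen to satisfy equation
      \<open>N\<close>; substituting it turns every other equation into the reduced one solved by
      \<open>d\<close>.\<close>
    define d' where "d' = d(j0 := - (\<Sum>j\<in>J'. d j * c j))"
    have eq: "(\<Sum>j\<in>J. d' j * M j i) = (\<Sum>j\<in>J'. d j * (M j i - c j * M j0 i))" for i
    proof -
      have "(\<Sum>j\<in>J'. d' j * M j i) = (\<Sum>j\<in>J'. d j * M j i)"
        using J(2) by (intro sum.cong) (auto simp: d'_def)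
      then show ?thesis using J
        by (simp add: d'_def algebra_simps sum_subtractf sum_distrib_left sum_distrib_right sum_negf)
    qed
    have "(\<Sum>j\<in>J. d' j * M j i) = 0" if "i < Suc N" for i
    proof (cases "i = N")
      case True
      have "M j N - c j * M j0 N = 0" for j using j0 by (simp add: c_def)
      then show ?thesis unfolding eq True by (simp only: mult_zero_right sum.neutral_const)
    next
      case False
      then show ?thesis unfolding eq using d(2) that by auto
    qed
    moreover have "\<exists>j\<in>J. d' j \<noteq> 0" using d(1) J by (auto simp: d'_def)
    ultimately show ?thesis by blast
  qed
qed

text \<open>The linear factors form a multiset, and a factor occurring twice would give a zero of
  the derivative. So the multiset is a set.\<close>

lemma card_roots_eq_degree:
  fixes p :: "'k::alg_closed_field poly"
  assumes "p \<noteq> 0" "\<And>a. poly p a = 0 \<Longrightarrow> poly (pderiv p) a \<noteq> 0"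
  shows "card {x. poly p x = 0} = degree p"
proof -
  obtain A where A: "size A = degree p" "p = smult (lead_coeff p) (\<Prod>x\<in>#A. [:-x, 1:])"
    using alg_closed_imp_factorization[OF assms(1)] by blast
  have c: "lead_coeff p \<noteq> 0" using assms(1) by simp
  have roots: "{x. poly p x = 0} = set_mset A"
    by (subst A(2)) (use c in \<open>auto simp: poly_prod_mset prod_mset_zero_iff\<close>)
  have "count A a \<le> 1" for a
  proof (rule ccontr)
    assume "\<not> count A a \<le> 1"
    then have a: "a \<in># A" "a \<in># A - {#a#}"
      by (auto simp flip: count_greater_zero_iff)
    then obtain B where "A = add_mset a (add_mset a B)"
      by (metis insert_DiffM)
    with A(2) have p: "p = [:-a, 1:] * ([:-a, 1:] * smult (lead_coeff p) (\<Prod>x\<in>#B. [:-x, 1:]))"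
      by (simp add: mult.left_commute)
    have "poly (pderiv p) a = 0" by (subst p, simp only: pderiv_mult) (simp add: pderiv_pCons)
    moreover have "poly p a = 0" by (subst p) simp
    ultimately show False using assms(2) by blast
  qed
  then have "size A = card (set_mset A)"
    unfolding size_multiset_overloaded_eq
    by (metis (no_types, lifting) card_eq_sum count_greater_eq_one_iff le_antisym sum.cong)
  then show ?thesis using A(1) roots by simp
qed

text \<open>Modulo \<open>m\<close> only \<open>F\<close>, \<open>k\<close>, \<open>c\<close> and
  \<open>l\<close> survive. It is applied with \<open>m\<close> the monomial of degree
  \<open>P\<close>, where \<open>k\<close> and \<open>l\<close> are the lowest blocks of lacunary
  sums and \<open>c\<close> is the constant term of \<open>F ^ P\<close>.\<close>

lemma dvd_diff_squares:
  fixes F k l m :: "'b::comm_ring_1"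
  assumes "F * (k + m * A)\<^sup>2 = (c + m * G) * (l + m * C)\<^sup>2"
  shows "m dvd F * k\<^sup>2 - c * l\<^sup>2"
proof -
  have "F * k\<^sup>2 - c * l\<^sup>2 = (F * (k + m * A)\<^sup>2 - (c + m * G) * (l + m * C)\<^sup>2)
      + m * (G * (l + m * C)\<^sup>2 + c * (2 * l * C + m * C\<^sup>2) - F * (2 * k * A + m * A\<^sup>2))"
    by (simp add: power2_eq_square algebra_simps)
  then show ?thesis using assms by simp
qed

text \<open>Abstracts a power of the odd characteristic by the properties that get used, without
  naming the prime. The vanishing of \<open>of_nat P\<close> kills the derivative of the
  \<open>P\<close>-th power.\<close>

definition frob_exp :: "'k::field itself \<Rightarrow> nat \<Rightarrow> bool" where
  "frob_exp _ P \<longleftrightarrow> odd P \<and> 1 < P \<and> of_nat P = (0::'k) \<and> (\<forall>x y::'k. (x + y) ^ P = x ^ P + y ^ P)"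

lemma frob_exp_power:
  assumes "frob_exp TYPE('k::field) q" "n > 0"
  shows "frob_exp TYPE('k) (q ^ n)"
  using assms(2)
proof (induction n rule: nat_induct_non_zero)
  case 1
  then show ?case using assms by simp
next
  case (Suc n)
  have "1 < q * q ^ n" using assms(1) Suc unfolding frob_exp_def
    by (metis less_1_mult)
  then show ?case using assms(1) Suc
    by (auto simp: frob_exp_def power_mult mult.commute[of q])
qed

section \<open>Frobenius powers over an algebraically closed field\<close>

context
  fixes P :: nat
  assumes P: "frob_exp TYPE('k::alg_closed_field) P"
begin

lemma frob_exp_pos: "P > 0" and frob_exp_odd: "odd P" and frob_exp_gt_1: "1 < P"
  using P by (auto simp: frob_exp_def)

lemma frob_add: "((x::'k) + y) ^ P = x ^ P + y ^ P"
  using P by (auto simp: frob_exp_def)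

lemma frob_minus: "(- (x::'k)) ^ P = - (x ^ P)"
  using frob_exp_odd by simp

lemma frob_diff: "((x::'k) - y) ^ P = x ^ P - y ^ P"
  using frob_add[of x "-y"] frob_minus by simp

lemma frob_sum: "((\<Sum>i\<in>I. f i) :: 'k) ^ P = (\<Sum>i\<in>I. f i ^ P)"
  by (induction I rule: infinite_finite_induct) (auto simp: frob_add zero_power frob_exp_pos)

lemma frob_exp_two_nonzero: "(2::'k) \<noteq> 0"
proof
  assume *: "(2::'k) = 0"
  from frob_exp_odd obtain m where "P = 2 * m + 1" by (auto elim: oddE)
  moreover have "of_nat P = (0::'k)" using P by (simp add: frob_exp_def)
  ultimately show False using * by simp
qed

lemma infinite_alg_closed: "infinite (UNIV :: 'k set)"
proof
  assume fin: "finite (UNIV :: 'k set)"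
  define p :: "'k poly" where "p = (\<Prod>a\<in>UNIV. [:- a, 1:]) + 1"
  have "degree (\<Prod>a\<in>(UNIV::'k set). [:- a, 1:]) = card (UNIV :: 'k set)"
    by (subst degree_prod_eq_sum_degree) auto
  moreover have "card (UNIV :: 'k set) > 0" using fin by (simp add: card_gt_0_iff)
  ultimately have "degree p > 0" unfolding p_def
    by (subst degree_add_eq_left) auto
  then obtain x where "poly p x = 0" using alg_closed_imp_poly_has_root by blast
  moreover have "poly p x = 1" using fin by (simp add: p_def poly_prod)
  ultimately show False by simp
qed

lemma poly_ext_alg_closed: "(\<And>x. poly p x = poly r x) \<Longrightarrow> p = (r :: 'k poly)"
proof (rule ccontr)
  assume *: "\<And>x. poly p x = poly r x" "p \<noteq> r"
  then have "finite {x. poly (p - r) x = 0}" by (intro poly_roots_finite) auto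
  with *(1) infinite_alg_closed show False by simp
qed

text \<open>The derivative of X^P - X is -1, so all roots are simple. The fixed points form the
  subfield with exactly \<open>P\<close> elements.\<close>

lemma card_fixed_points: "card {x::'k. x ^ P = x} = P"
proof -
  define p :: "'k poly" where "p = monom 1 P - monom 1 1"
  have deg: "degree p = P" unfolding p_def using frob_exp_gt_1
    by (subst diff_conv_add_uminus, subst degree_add_eq_left) (auto simp: degree_monom_eq)
  have "card {x. poly p x = 0} = degree p"
  proof (rule card_roots_eq_degree)
    fix a assume "poly p a = 0"
    moreover have "of_nat P = (0::'k)" using P by (simp add: frob_exp_def)
    ultimately show "poly (pderiv p) a \<noteq> 0" by (simp add: p_def pderiv_diff pderiv_monom poly_monom)
  qed (use deg frob_exp_gt_1 in auto)
  then show ?thesis by (simp add: deg) (simp add: p_def poly_monom)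
qed

text \<open>By additivity of the \<open>P\<close>-th power, \<open>F ^ P\<close> is a polynomial in
  X^P whose constant term is the \<open>P\<close>-th power of that of \<open>F\<close>. Pointwise
  equality suffices because the field is infinite.\<close>

lemma poly_pow_expand:
  fixes F :: "'k poly"
  shows "\<exists>G. F ^ P = [:poly F 0 ^ P:] + monom 1 P * G"
proof -
  obtain c F1 where F: "F = pCons c F1" by (cases F)
  have "F ^ P = [:c ^ P:] + monom 1 P * F1 ^ P"
    by (rule poly_ext_alg_closed) (simp add: F poly_monom frob_add power_mult_distrib)
  then show ?thesis by (auto simp: F)
qed

text \<open>Isolates the first block that may be nonzero: all later blocks carry another factor X^P
  and vanish modulo it.\<close>

lemma lacunary_split:
  fixes k :: "nat \<Rightarrow> 'k poly"
  assumes "\<And>i. i < i0 \<Longrightarrow> k i = 0" "i0 < I"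
  shows "\<exists>A. (\<Sum>i<I. k i * monom 1 (i * P)) = monom 1 (i0 * P) * (k i0 + monom 1 P * A)"
proof -
  have I: "{..<I} = {..<i0} \<union> insert i0 {i0<..<I}" using assms(2) by auto
  have "(\<Sum>i<I. k i * monom 1 (i * P)) = k i0 * monom 1 (i0 * P) + (\<Sum>i\<in>{i0<..<I}. k i * monom 1 (i * P))"
    unfolding I using assms by (subst sum.union_disjoint) auto
  also have "(\<Sum>i\<in>{i0<..<I}. k i * monom 1 (i * P)) =
      (\<Sum>i\<in>{i0<..<I}. monom 1 (i0 * P) * monom 1 P * (k i * monom 1 ((i - i0 - 1) * P)))"
  proof (rule sum.cong)
    fix i assume "i \<in> {i0<..<I}"
    then have "i = i0 + 1 + (i - i0 - 1)" by auto
    then have "i * P = i0 * P + P + (i - i0 - 1) * P"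
      by (metis add_mult_distrib mult_1)
    then have "(monom 1 (i * P) :: 'k poly) = monom 1 (i0 * P) * monom 1 P * monom 1 ((i - i0 - 1) * P)"
      by (simp add: mult_monom)
    then show "k i * monom 1 (i * P) = monom 1 (i0 * P) * monom 1 P * (k i * monom 1 ((i - i0 - 1) * P))"
      by (simp add: ac_simps)
  qed auto
  finally show ?thesis
    by (intro exI[of _ "\<Sum>i\<in>{i0<..<I}. k i * monom 1 ((i - i0 - 1) * P)"])
       (simp add: sum_distrib_left algebra_simps)
qed

text \<open>If the sum vanished, squaring and one more factor \<open>F\<close> would give an
  identity between \<open>F\<close> times a square and \<open>F ^ P\<close> times a square. The
  lowest blocks agree modulo X^P and have degree below \<open>P\<close>, so \<open>F\<close> times a
  square equals a constant times a square. At the simple root \<open>\<rho>\<close> the order of the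
  left side is odd and that of the right side even.\<close>

lemma lacunary_nonzero:
  fixes k l :: "nat \<Rightarrow> 'k poly" and F :: "'k poly"
  assumes F0: "poly F 0 \<noteq> 0" and ord: "order \<rho> F = 1"
    and deg: "\<And>i. degree (k i) < B" "\<And>i. degree (l i) < B" "degree F + 2 * B \<le> P + 1"
    and ex: "\<exists>i<I. k i \<noteq> 0 \<or> l i \<noteq> 0" and h: "P = 2 * h + 1"
  shows "(\<Sum>i<I. k i * monom 1 (i * P)) + F ^ h * (\<Sum>i<I. l i * monom 1 (i * P)) \<noteq> 0"
proof
  define A where "A = (\<Sum>i<I. k i * monom 1 (i * P))"
  define C where "C = (\<Sum>i<I. l i * monom 1 (i * P))"
  assume "(\<Sum>i<I. k i * monom 1 (i * P)) + F ^ h * (\<Sum>i<I. l i * monom 1 (i * P)) = 0"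
  then have "A = - (F ^ h * C)" by (simp add: A_def C_def add_eq_0_iff)
  then have "F * A\<^sup>2 = F ^ P * C\<^sup>2"
    unfolding h by (simp add: power_mult_distrib power_add power_mult[symmetric] mult.commute)
  define i0 where "i0 = (LEAST i. k i \<noteq> 0 \<or> l i \<noteq> 0)"
  obtain i1 where i1: "i1 < I" "k i1 \<noteq> 0 \<or> l i1 \<noteq> 0" using ex by blast
  have i0: "k i0 \<noteq> 0 \<or> l i0 \<noteq> 0" unfolding i0_def using i1(2) by (rule LeastI)
  have below: "k i = 0" "l i = 0" if "i < i0" for i
    using not_less_Least[OF that[unfolded i0_def]] by auto
  have "i0 \<le> i1" unfolding i0_def using i1(2) by (rule Least_le)
  with i1(1) have "i0 < I" by simp
  obtain A1 where A1: "A = monom 1 (i0 * P) * (k i0 + monom 1 P * A1)"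
    using lacunary_split[of i0 k I] below \<open>i0 < I\<close> unfolding A_def by blast
  obtain C1 where C1: "C = monom 1 (i0 * P) * (l i0 + monom 1 P * C1)"
    using lacunary_split[of i0 l I] below \<open>i0 < I\<close> unfolding C_def by blast
  obtain G where G: "F ^ P = [:poly F 0 ^ P:] + monom 1 P * G" using poly_pow_expand by blast
  define c where "c = poly F 0 ^ P"
  have c: "c \<noteq> 0" using F0 by (simp add: c_def)
  have "monom 1 (i0 * P) ^ 2 * (F * (k i0 + monom 1 P * A1)\<^sup>2)
      = monom 1 (i0 * P) ^ 2 * (([:c:] + monom 1 P * G) * (l i0 + monom 1 P * C1)\<^sup>2)"
    using \<open>F * A\<^sup>2 = F ^ P * C\<^sup>2\<close> unfolding A1 C1 G c_def by (simp add: power_mult_distrib ac_simps)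
  then have "F * (k i0 + monom 1 P * A1)\<^sup>2 = ([:c:] + monom 1 P * G) * (l i0 + monom 1 P * C1)\<^sup>2"
    by (simp add: monom_eq_0_iff)
  then have dvd: "monom 1 P dvd F * (k i0)\<^sup>2 - [:c:] * (l i0)\<^sup>2"
    by (rule dvd_diff_squares)
  have "degree (F * (k i0)\<^sup>2) \<le> degree F + 2 * (B - 1)"
    using deg(1)[of i0] by (intro order_trans[OF degree_mult_le] add_left_mono order_trans[OF degree_power_le]) auto
  moreover have "degree ([:c:] * (l i0)\<^sup>2) \<le> 2 * (B - 1)"
    using deg(2)[of i0] by (intro order_trans[OF degree_mult_le] order_trans[OF add_left_mono[OF degree_power_le]]) auto
  ultimately have "degree (F * (k i0)\<^sup>2 - [:c:] * (l i0)\<^sup>2) \<le> degree F + 2 * (B - 1)"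
    by (intro degree_diff_le) auto
  also have "\<dots> < P" using deg(3) deg(1)[of i0] by simp
  finally have "F * (k i0)\<^sup>2 - [:c:] * (l i0)\<^sup>2 = 0"
    using dvd_imp_degree_le[OF dvd] by (auto simp: degree_monom_eq)
  then have eq: "F * (k i0)\<^sup>2 = smult c ((l i0)\<^sup>2)" by simp
  have "F \<noteq> 0" using F0 by auto
  have nz: "k i0 \<noteq> 0" "l i0 \<noteq> 0" using eq i0 c \<open>F \<noteq> 0\<close> by auto
  have "order \<rho> (F * (k i0 * k i0)) = 1 + (order \<rho> (k i0) + order \<rho> (k i0))"
    using nz \<open>F \<noteq> 0\<close> ord by (simp add: order_mult)
  moreover have "order \<rho> (smult c (l i0 * l i0)) = order \<rho> (l i0) + order \<rho> (l i0)"
    using nz c by (simp add: order_smult order_mult)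
  ultimately have "1 + (order \<rho> (k i0) + order \<rho> (k i0)) = order \<rho> (l i0) + order \<rho> (l i0)"
    using eq by (simp add: power2_eq_square)
  then show False by presburger
qed

text \<open>On the points that are counted, \<open>F^h * H^P\<close> agrees with a polynomial that linear algebra makes
  identically zero, so \<open>H\<close> vanishes there. Working with \<open>H\<close> rather than with \<open>H^P\<close> takes the place of the
  derivatives in Stepanov's argument.\<close>

lemma stepanov:
  fixes F :: "'k poly"
  assumes F0: "poly F 0 \<noteq> 0" and ord: "order \<rho> F = 1" and D: "degree F = D"
    and h: "P = 2 * h + 1" and large: "2 * D + 2 \<le> h" and \<epsilon>: "\<epsilon> \<noteq> 0"
  shows "2 * card {x. x ^ P\<^sup>2 = x \<and> poly F x ^ ((P\<^sup>2 - 1) div 2) = \<epsilon>} \<le> P\<^sup>2 + (3 * D + 5) * P"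
proof -
  define S where "S = {x. x ^ P\<^sup>2 = x \<and> poly F x ^ ((P\<^sup>2 - 1) div 2) = \<epsilon>}"
  \<comment> \<open>There are 2 \<open>I\<close> \<open>B\<close> unknowns and \<open>N\<close>
    equations. \<open>B\<close> is small enough for the degree condition of the non-vanishing lemma;
    the surplus D + 2 in \<open>I\<close> then lets the unknowns outnumber the equations, while
    \<open>I\<close> close to P/2 keeps the degree of \<open>H\<close> near P^2/2, half the size of
    the field.\<close>
  define I where "I = h + D + 2"
  define B where "B = h - D"
  define N where "N = D * h + I + P * B"
  define J where "J = (UNIV::bool set) \<times> {..<I} \<times> {..<B}"
  have hB: "h = B + D" using large by (simp add: B_def)
  have N: "N < card J"
  proof -
    have "B \<ge> D + 2" using large hB by simp
    then obtain r where r: "B = D + 2 + r" by (metis le_Suc_ex)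
    show ?thesis unfolding N_def J_def I_def h hB
      by (simp add: card_cartesian_product r algebra_simps)
  qed
  \<comment> \<open>On the counted points x^(P^2) = x and F^h * F^(h P) = \<epsilon>, so F^h * H^P
    reduces there to a combination of the \<open>v\<close>. Their degrees stay below
    \<open>N\<close>, far below that of H^P.\<close>
  define v :: "bool \<times> nat \<times> nat \<Rightarrow> 'k poly"
    where "v = (\<lambda>(s,i,b). (if s then F ^ h else [:\<epsilon>:]) * monom 1 (i + P * b))"
  have vdeg: "degree (v j) < N" if "j \<in> J" for j
  proof -
    obtain s i b where j: "j = (s, i, b)" by (cases j)
    with that have ib: "i < I" "b < B" by (auto simp: J_def)
    have "degree (v j) \<le> degree (if s then F ^ h else [:\<epsilon>:]) + degree (monom (1::'k) (i + P * b))"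
      unfolding v_def j by (simp add: degree_mult_le)
    also have "\<dots> \<le> D * h + (i + P * b)"
      by (intro add_mono) (auto simp: degree_monom_eq D mult.commute intro: order_trans[OF degree_power_le])
    also have "\<dots> < N" using ib by (simp add: N_def add_less_le_mono)
    finally show ?thesis .
  qed
  obtain d where d: "\<exists>j\<in>J. d j \<noteq> 0" "\<And>i. i < N \<Longrightarrow> (\<Sum>j\<in>J. d j * coeff (v j) i) = 0"
    using underdetermined_system[OF _ N, of "\<lambda>j. coeff (v j)"] by (auto simp: J_def)
  have T0: "(\<Sum>j\<in>J. smult (d j) (v j)) = 0"
  proof (rule poly_eqI)
    fix i
    show "coeff (\<Sum>j\<in>J. smult (d j) (v j)) i = coeff 0 i"
    proof (cases "i < N")
      case True
      then show ?thesis using d(2) by (simp add: coeff_sum)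
    next
      case False
      then have "coeff (v j) i = 0" if "j \<in> J" for j
        using vdeg[OF that] by (intro coeff_eq_0) auto
      then show ?thesis by (simp add: coeff_sum)
    qed
  qed
  \<comment> \<open>Linear algebra yields the \<open>P\<close>-th powers of the coefficients of
    \<open>H\<close>; the coefficients themselves exist because the field is algebraically
    closed.\<close>
  have "\<exists>y. y ^ P = d j" for j using nth_root_exists[of P "d j"] frob_exp_pos by auto
  then obtain c where c: "\<And>j. c j ^ P = d j" by metis
  define k where "k s i = (\<Sum>b<B. monom (c (s, i, b)) b)" for s i
  have "B > 0" using hB large by simp
  have kdeg: "degree (k s i) < B" for s i
  proof -
    have "degree (k s i) \<le> B - 1" unfolding k_def
      by (intro degree_sum_le) (auto intro: order_trans[OF degree_monom_le])
    then show ?thesis using \<open>B > 0\<close> by simp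
  qed
  have kpow: "poly (k s i) x ^ P = (\<Sum>b<B. d (s, i, b) * x ^ (P * b))" for s i x
    by (simp add: k_def poly_sum poly_monom frob_sum power_mult_distrib c power_mult[symmetric] mult.commute)
  define H where "H = (\<Sum>i<I. k True i * monom 1 (i * P)) + F ^ h * (\<Sum>i<I. k False i * monom 1 (i * P))"
  have H: "H \<noteq> 0" unfolding H_def
  proof (rule lacunary_nonzero[OF F0 ord, of _ B])
    show "degree F + 2 * B \<le> P + 1" using D h hB by simp
    obtain s i b where sib: "i < I" "b < B" "d (s, i, b) \<noteq> 0" using d(1) by (auto simp: J_def)
    then have "c (s, i, b) \<noteq> 0" using c[of "(s,i,b)"] frob_exp_pos by (auto simp: zero_power)
    moreover have "coeff (k s i) b = c (s, i, b)"
      using sib by (simp add: k_def coeff_sum coeff_monom)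
    ultimately have "k s i \<noteq> 0" by auto
    with sib(1) show "\<exists>i<I. k True i \<noteq> 0 \<or> k False i \<noteq> 0" by (cases s) auto
  qed (use kdeg h in auto)
  have root: "poly H x = 0" if x: "x \<in> S" for x
  proof -
    have x1: "x ^ P\<^sup>2 = x" and x2: "poly F x ^ ((P\<^sup>2 - 1) div 2) = \<epsilon>" using x by (auto simp: S_def)
    have e: "(P\<^sup>2 - 1) div 2 = h * P + h" by (simp add: h power2_eq_square algebra_simps)
    have x3: "\<epsilon> = poly F x ^ h * poly F x ^ (h * P)"
      using x2 unfolding e by (simp add: power_add mult.commute)
    have xp: "((x ^ i) ^ P) ^ P = x ^ i" for i
      by (metis x1 power2_eq_square power_mult mult.commute)
    have Hp: "poly H x ^ P = (\<Sum>i<I. poly (k True i) x ^ P * x ^ i)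
        + poly F x ^ (h * P) * (\<Sum>i<I. poly (k False i) x ^ P * x ^ i)"
      by (simp add: H_def poly_sum poly_monom frob_add frob_sum power_mult_distrib xp power_mult)
    have "0 = poly (\<Sum>j\<in>J. smult (d j) (v j)) x" using T0 by simp
    also have "\<dots> = (\<Sum>s\<in>UNIV. \<Sum>i<I. \<Sum>b<B. d (s, i, b) * poly (v (s, i, b)) x)"
      unfolding J_def by (simp add: poly_sum sum.cartesian_product split_def)
    also have "\<dots> = poly F x ^ h * (\<Sum>i<I. poly (k True i) x ^ P * x ^ i) + \<epsilon> * (\<Sum>i<I. poly (k False i) x ^ P * x ^ i)"
      by (simp add: UNIV_bool v_def kpow poly_monom sum_distrib_left sum_distrib_right power_add ac_simps)
    also have "\<dots> = poly F x ^ h * poly H x ^ P"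
      unfolding Hp x3 by (simp add: algebra_simps)
    finally have "poly F x ^ h * poly H x ^ P = 0" by simp
    moreover have "poly F x \<noteq> 0" using x3 \<epsilon> large by (auto simp: zero_power)
    ultimately show ?thesis by simp
  qed
  have "card S \<le> card {x. poly H x = 0}"
    using root H by (intro card_mono poly_roots_finite) auto
  also have "\<dots> \<le> degree H" by (rule card_poly_roots_bound[OF H])
  also have "degree H \<le> D * h + (B + I * P)"
  proof -
    have s: "degree (\<Sum>i<I. k s i * monom 1 (i * P)) \<le> B + I * P" for s
    proof (rule degree_sum_le)
      fix i assume "i \<in> {..<I}"
      have "degree (k s i * monom 1 (i * P)) \<le> degree (k s i) + degree (monom (1::'k) (i * P))"
        by (rule degree_mult_le)
      also have "\<dots> \<le> B + I * P"
        using kdeg[of s i] \<open>i \<in> {..<I}\<close> by (intro add_mono) (auto simp: degree_monom_eq)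
      finally show "degree (k s i * monom 1 (i * P)) \<le> B + I * P" .
    qed auto
    have f: "degree (F ^ h) \<le> D * h" using degree_power_le[of F h] by (simp add: D mult.commute)
    show ?thesis unfolding H_def
      using s[of True] order_trans[OF degree_mult_le add_mono[OF f s[of False]]]
      by (intro degree_add_le) auto
  qed
  finally have "2 * card S \<le> 2 * (D * h + (B + I * P))" by simp
  \<comment> \<open>Here 2 I P is P^2 + (2 D + 3) P, and since 2 h < P the rest, 2 D h + 2 B, is at
    most (D + 1) P.\<close>
  also have "\<dots> \<le> P\<^sup>2 + (3 * D + 5) * P"
    unfolding I_def h hB by (simp add: power2_eq_square algebra_simps)
  finally show ?thesis by (simp add: S_def)
qed

end

section \<open>Kloosterman sums\<close>

text \<open>For a Frobenius exponent this is the subfield with \<open>P\<close> elements. As sets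
  inside one algebraically closed type, all levels of the tower coexist, with inclusions in place of
  embeddings.\<close>

definition fixed_by_power :: "nat \<Rightarrow> 'k::field set" where
  "fixed_by_power P = {x. x ^ P = x}"

definition additive_character :: "'k::field set \<Rightarrow> ('k \<Rightarrow> complex) \<Rightarrow> bool" where
  "additive_character S \<psi> \<longleftrightarrow> (\<forall>x\<in>S. \<forall>y\<in>S. \<psi> (x + y) = \<psi> x * \<psi> y) \<and> (\<forall>x\<in>S. norm (\<psi> x) = 1)
     \<and> (\<exists>x\<in>S. \<psi> x \<noteq> 1)"

definition kloosterman :: "'k::field set \<Rightarrow> ('k \<Rightarrow> complex) \<Rightarrow> 'k \<Rightarrow> complex" where
  "kloosterman S \<psi> a = (\<Sum>x\<in>S - {0}. \<psi> (x + a / x))"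

lemma sum_character_zero:
  assumes fin: "finite S" and add: "\<And>x y. x \<in> S \<Longrightarrow> y \<in> S \<Longrightarrow> x + y \<in> S"
    and neg: "\<And>x. x \<in> S \<Longrightarrow> - x \<in> S" and \<psi>: "additive_character S \<psi>"
  shows "(\<Sum>x\<in>S. \<psi> x) = 0"
proof -
  obtain c where c: "c \<in> S" "\<psi> c \<noteq> 1" using \<psi> by (auto simp: additive_character_def)
  have "(\<Sum>x\<in>S. \<psi> x) = (\<Sum>x\<in>S. \<psi> (x + c))"
    by (rule sum.reindex_bij_witness[of _ "\<lambda>x. x + c" "\<lambda>x. x + (- c)"]) (use c add neg add[OF _ neg] in \<open>auto simp del: add_uminus_conv_diff\<close>)
  also have "\<dots> = (\<Sum>x\<in>S. \<psi> x) * \<psi> c"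
    using c \<psi> by (simp add: additive_character_def sum_distrib_right)
  finally show ?thesis using c(2) by simp
qed

lemma sum_by_fibres:
  fixes g :: "'b \<Rightarrow> 'c::comm_semiring_1"
  assumes "finite A" "finite B" "f ` A \<subseteq> B"
  shows "(\<Sum>x\<in>A. g (f x)) = (\<Sum>y\<in>B. of_nat (card {x\<in>A. f x = y}) * g y)"
proof -
  have "(\<Sum>x\<in>A. g (f x)) = (\<Sum>y\<in>B. \<Sum>x\<in>{x\<in>A. f x = y}. g (f x))"
    using assms by (intro sum.group[symmetric]) auto
  also have "\<dots> = (\<Sum>y\<in>B. of_nat (card {x\<in>A. f x = y}) * g y)"
    by (intro sum.cong refl) simp
  finally show ?thesis .
qed

section \<open>The subfield with P elements and its quadratic extension\<close>

context
  fixes P :: nat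
  assumes P: "frob_exp TYPE('k::alg_closed_field) P"
begin

abbreviation "\<F> \<equiv> fixed_by_power P :: 'k set"

lemma finite_fixed_by_power: "finite \<F>" and card_fixed_by_power: "card \<F> = P"
  using card_fixed_points[OF P] frob_exp_pos[OF P] unfolding fixed_by_power_def by (auto intro: card_ge_0_finite)

lemma fixed_by_power_0_1: "0 \<in> \<F>" "1 \<in> \<F>"
  using frob_exp_pos[OF P] by (auto simp: fixed_by_power_def zero_power)

lemma fixed_by_power_add: "x \<in> \<F> \<Longrightarrow> y \<in> \<F> \<Longrightarrow> x + y \<in> \<F>"
  and fixed_by_power_diff: "x \<in> \<F> \<Longrightarrow> y \<in> \<F> \<Longrightarrow> x - y \<in> \<F>"
  and fixed_by_power_minus: "x \<in> \<F> \<Longrightarrow> - x \<in> \<F>"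
  and fixed_by_power_mult: "x \<in> \<F> \<Longrightarrow> y \<in> \<F> \<Longrightarrow> x * y \<in> \<F>"
  and fixed_by_power_divide: "x \<in> \<F> \<Longrightarrow> y \<in> \<F> \<Longrightarrow> x / y \<in> \<F>"
  and fixed_by_power_pow: "x \<in> \<F> \<Longrightarrow> x ^ n \<in> \<F>"
  by (auto simp: fixed_by_power_def frob_add[OF P] frob_diff[OF P] frob_minus[OF P] power_mult_distrib
      power_divide) (metis power_commutes power_mult mult.commute)

lemma fixed_by_power_2: "2 \<in> \<F>" and fixed_by_power_4: "4 \<in> \<F>"
  using fixed_by_power_add[of 1 1] fixed_by_power_add[of 2 2] fixed_by_power_0_1 by auto

lemma fixed_by_power_add_divide: "x \<in> \<F> \<Longrightarrow> y \<in> \<F> \<Longrightarrow> x + y / z \<in> \<F>" if "z \<in> \<F>"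
  using fixed_by_power_add fixed_by_power_divide that by auto

lemma sum_character_mult:
  assumes \<psi>: "additive_character \<F> \<psi>" and b: "b \<in> \<F>"
  shows "(\<Sum>x\<in>\<F>. \<psi> (x * b)) = (if b = 0 then of_nat P else 0)"
proof (cases "b = 0")
  case True
  have "\<psi> (0 + 0) = \<psi> 0 * \<psi> 0" "norm (\<psi> 0) = 1"
    using \<psi> fixed_by_power_0_1 unfolding additive_character_def by blast+
  then have "\<psi> 0 = 1" by (metis add_0 mult_cancel_right1 norm_zero zero_neq_one)
  with True show ?thesis by (simp add: card_fixed_by_power)
next
  case False
  have "(\<Sum>x\<in>\<F>. \<psi> (x * b)) = (\<Sum>x\<in>\<F>. \<psi> x)"
    by (rule sum.reindex_bij_witness[of _ "\<lambda>x. x / b" "\<lambda>x. x * b"]) (use b False fixed_by_power_mult fixed_by_power_divide in auto)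
  also have "\<dots> = 0" by (rule sum_character_zero[OF finite_fixed_by_power fixed_by_power_add fixed_by_power_minus \<psi>])
  finally show ?thesis using False by simp
qed

text \<open>A monic quadratic over the fixed field has either two roots in it, or two conjugate roots in
  its quadratic extension, or a double root that is seen once by either count.\<close>

lemma quadratic_count:
  assumes s: "s \<in> \<F>" and n: "n \<in> \<F>"
  shows "card {x\<in>fixed_by_power (P\<^sup>2). x + x ^ P = s \<and> x * x ^ P = n}
       + card {z\<in>\<F> \<times> \<F>. fst z + snd z = s \<and> fst z * snd z = n} = 2"
proof -
  have "degree [:n, - s, 1:] > 0" by simp
  then obtain u where u: "poly [:n, - s, 1:] u = 0" using alg_closed_imp_poly_has_root by blast
  define v where "v = s - u"
  have "u * v = n - poly [:n, - s, 1:] u" by (simp add: v_def algebra_simps)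
  with u have uv: "u + v = s" "u * v = n" by (simp_all add: v_def)
  have pair: "x + y = s \<and> x * y = n \<longleftrightarrow> x = u \<and> y = v \<or> x = v \<and> y = u" for x y
  proof
    assume xy: "x + y = s \<and> x * y = n"
    have "(x - u) * (x - v) = x * x - (u + v) * x + u * v" by (simp add: algebra_simps)
    also have "\<dots> = x * x - (x + y) * x + x * y" using xy uv by simp
    also have "\<dots> = 0" by (simp add: algebra_simps)
    finally have "(x - u) * (x - v) = 0" .
    then have "x = u \<or> x = v" by simp
    then show "x = u \<and> y = v \<or> x = v \<and> y = u"
    proof
      assume "x = u"
      with xy uv show ?thesis by (metis add_left_cancel)
    next
      assume "x = v"
      with xy uv show ?thesis by (metis add_left_cancel add.commute)
    qed
  qed (use uv in \<open>auto simp: ac_simps\<close>)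
  \<comment> \<open>Frobenius fixes \<open>s\<close> and \<open>n\<close> and therefore permutes the
    two roots; whether it fixes or swaps them decides which of the two sets they are counted
    in.\<close>
  have "u ^ P + v ^ P = s" "u ^ P * v ^ P = n"
    unfolding frob_add[OF P, symmetric] power_mult_distrib[symmetric] uv
    using s n by (simp_all only: fixed_by_power_def mem_Collect_eq)
  then have conj: "u ^ P = u \<and> v ^ P = v \<or> u ^ P = v \<and> v ^ P = u" using pair[of "u ^ P" "v ^ P"] by blast
  have sq: "x ^ P\<^sup>2 = (x ^ P) ^ P" for x :: 'k by (simp add: power2_eq_square power_mult)
  show ?thesis
  proof (cases "u = v")
    case True
    with conj have "u ^ P = u" by auto
    with True have "{x\<in>fixed_by_power (P\<^sup>2). x + x ^ P = s \<and> x * x ^ P = n} = {u}"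
        "{z\<in>\<F> \<times> \<F>. fst z + snd z = s \<and> fst z * snd z = n} = {(u, u)}"
      unfolding pair by (auto simp: fixed_by_power_def sq)
    then show ?thesis by simp
  next
    case ne: False
    show ?thesis
    proof (cases "u ^ P = u \<and> v ^ P = v")
      case True
      then have sets: "{x\<in>fixed_by_power (P\<^sup>2). x + x ^ P = s \<and> x * x ^ P = n} = {}"
        "{z\<in>\<F> \<times> \<F>. fst z + snd z = s \<and> fst z * snd z = n} = {(u, v), (v, u)}"
        using ne unfolding pair by (auto simp: fixed_by_power_def)
      show ?thesis unfolding sets using ne by simp
    next
      case False
      with conj have c: "u ^ P = v" "v ^ P = u" by auto
      then have sets: "{x\<in>fixed_by_power (P\<^sup>2). x + x ^ P = s \<and> x * x ^ P = n} = {u, v}"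
        "{z\<in>\<F> \<times> \<F>. fst z + snd z = s \<and> fst z * snd z = n} = {}"
        using ne unfolding pair by (auto simp: fixed_by_power_def sq)
      show ?thesis unfolding sets using ne by simp
    qed
  qed
qed

text \<open>A Hasse-Davenport relation of degree two. The sum over the extension and the square of
  the sum below both depend only on a sum \<open>s\<close> and a product \<open>n\<close>: trace and
  norm of one element there, sum and product of a pair here. By the count for quadratics the
  multiplicities add up to 2, and in the resulting free sum over \<open>s\<close> only n = -a
  survives.\<close>

lemma kloosterman_quadratic_extension:
  assumes \<psi>: "additive_character \<F> \<psi>" and a: "a \<in> \<F>" "a \<noteq> 0"
  shows "kloosterman (fixed_by_power (P\<^sup>2)) (\<lambda>x. \<psi> (x + x ^ P)) a = 2 * of_nat P - (kloosterman \<F> \<psi> a)\<^sup>2"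
proof -
  define S2 :: "'k set" where "S2 = fixed_by_power (P\<^sup>2)"
  have P2: "frob_exp TYPE('k) (P\<^sup>2)" by (rule frob_exp_power[OF P]) simp
  have fin2: "finite S2" using card_fixed_points[OF P2] frob_exp_pos[OF P2]
    unfolding S2_def fixed_by_power_def by (intro card_ge_0_finite) simp
  have sq: "x ^ P\<^sup>2 = (x ^ P) ^ P" for x :: 'k by (simp add: power2_eq_square power_mult)
  define g where "g = (\<lambda>(s, n). \<psi> (s + a * s / n))"
  define Y where "Y = \<F> \<times> (\<F> - {0})"
  have finY: "finite Y" using finite_fixed_by_power by (simp add: Y_def)
  have "kloosterman S2 (\<lambda>x. \<psi> (x + x ^ P)) a = (\<Sum>x\<in>S2 - {0}. g (x + x ^ P, x * x ^ P))"
    unfolding kloosterman_def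
  proof (rule sum.cong)
    fix x assume "x \<in> S2 - {0}"
    then have "x + a / x + (x + a / x) ^ P = x + x ^ P + a * (x + x ^ P) / (x * x ^ P)"
      using a by (simp add: frob_add[OF P] power_divide fixed_by_power_def field_simps)
    then show "\<psi> (x + a / x + (x + a / x) ^ P) = g (x + x ^ P, x * x ^ P)" by (simp only: g_def prod.case)
  qed simp
  also have "\<dots> = (\<Sum>y\<in>Y. of_nat (card {x\<in>S2 - {0}. (x + x ^ P, x * x ^ P) = y}) * g y)"
    using fin2 finY by (intro sum_by_fibres)
      (auto simp: Y_def S2_def fixed_by_power_def frob_add[OF P] power_mult_distrib sq[symmetric] ac_simps)
  finally have K2: "kloosterman S2 (\<lambda>x. \<psi> (x + x ^ P)) a = \<dots>" .
  have "(kloosterman \<F> \<psi> a)\<^sup>2 = (\<Sum>z\<in>(\<F> - {0}) \<times> (\<F> - {0}). \<psi> (fst z + a / fst z) * \<psi> (snd z + a / snd z))"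
    by (simp add: kloosterman_def power2_eq_square sum_product sum.cartesian_product split_def)
  also have "\<dots> = (\<Sum>z\<in>(\<F> - {0}) \<times> (\<F> - {0}). g (fst z + snd z, fst z * snd z))"
  proof (rule sum.cong)
    fix z assume "z \<in> (\<F> - {0}) \<times> (\<F> - {0})"
    then obtain x y where z: "z = (x, y)" "x \<in> \<F>" "y \<in> \<F>" "x \<noteq> 0" "y \<noteq> 0" by auto
    then have "\<psi> (x + a / x) * \<psi> (y + a / y) = \<psi> ((x + a / x) + (y + a / y))"
      using \<psi> a fixed_by_power_add_divide by (auto simp: additive_character_def)
    also have "(x + a / x) + (y + a / y) = x + y + a * (x + y) / (x * y)"
      using z by (simp add: field_simps)
    finally show "\<psi> (fst z + a / fst z) * \<psi> (snd z + a / snd z) = g (fst z + snd z, fst z * snd z)"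
      by (simp add: g_def z)
  qed simp
  also have "\<dots> = (\<Sum>y\<in>Y. of_nat (card {z\<in>(\<F> - {0}) \<times> (\<F> - {0}). (fst z + snd z, fst z * snd z) = y}) * g y)"
    using finite_fixed_by_power finY by (intro sum_by_fibres) (auto simp: Y_def intro: fixed_by_power_add fixed_by_power_mult)
  finally have K1: "(kloosterman \<F> \<psi> a)\<^sup>2 = \<dots>" .
  have "kloosterman S2 (\<lambda>x. \<psi> (x + x ^ P)) a + (kloosterman \<F> \<psi> a)\<^sup>2 = (\<Sum>y\<in>Y. 2 * g y)"
    unfolding K1 K2 sum.distrib[symmetric]
  proof (rule sum.cong)
    fix y assume "y \<in> Y"
    then obtain s n where y: "y = (s, n)" "s \<in> \<F>" "n \<in> \<F>" "n \<noteq> 0" by (auto simp: Y_def)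
    have *: "{x\<in>S2 - {0}. (x + x ^ P, x * x ^ P) = y} = {x\<in>S2. x + x ^ P = s \<and> x * x ^ P = n}"
      "{z\<in>(\<F> - {0}) \<times> (\<F> - {0}). (fst z + snd z, fst z * snd z) = y}
        = {z\<in>\<F> \<times> \<F>. fst z + snd z = s \<and> fst z * snd z = n}"
      using y by auto
    show "of_nat (card {x\<in>S2 - {0}. (x + x ^ P, x * x ^ P) = y}) * g y +
       of_nat (card {z\<in>(\<F> - {0}) \<times> (\<F> - {0}). (fst z + snd z, fst z * snd z) = y}) * g y = 2 * g y"
      unfolding * distrib_right[symmetric] of_nat_add[symmetric] unfolding S2_def quadratic_count[OF y(2,3)] by simp
  qed simp
  also have "\<dots> = 2 * (\<Sum>n\<in>\<F> - {0}. \<Sum>s\<in>\<F>. \<psi> (s * (1 + a / n)))"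
    unfolding Y_def sum_distrib_left[symmetric] sum.cartesian_product[symmetric] g_def
    by (subst sum.swap) (simp add: sum.cartesian_product[symmetric] algebra_simps)
  also have "(\<Sum>n\<in>\<F> - {0}. \<Sum>s\<in>\<F>. \<psi> (s * (1 + a / n))) = (\<Sum>n\<in>\<F> - {0}. if n = - a then of_nat P else 0)"
  proof (rule sum.cong)
    fix n assume n: "n \<in> \<F> - {0}"
    then have "1 + a / n = 0 \<longleftrightarrow> n = - a" by (auto simp: field_simps add_eq_0_iff)
    with n a show "(\<Sum>s\<in>\<F>. \<psi> (s * (1 + a / n))) = (if n = - a then of_nat P else 0)"
      by (subst sum_character_mult[OF \<psi>]) (auto intro: fixed_by_power_add_divide fixed_by_power_0_1)
  qed simp
  also have "\<dots> = of_nat P" using a fixed_by_power_minus finite_fixed_by_power by simp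
  finally show ?thesis by (simp add: S2_def algebra_simps)
qed

lemma quadratic_extension_character:
  assumes \<psi>: "additive_character \<F> \<psi>"
  shows "additive_character (fixed_by_power (P\<^sup>2)) (\<lambda>x. \<psi> (x + x ^ P))"
proof -
  have sq: "x ^ P\<^sup>2 = (x ^ P) ^ P" for x :: 'k by (simp add: power2_eq_square power_mult)
  have tr: "x + x ^ P \<in> \<F>" if "x \<in> fixed_by_power (P\<^sup>2)" for x
    using that by (simp add: fixed_by_power_def frob_add[OF P] sq add.commute)
  obtain c where c: "c \<in> \<F>" "\<psi> c \<noteq> 1" using \<psi> by (auto simp: additive_character_def)
  \<comment> \<open>In odd characteristic \<open>c / 2\<close> is an element of the small field
    whose trace is \<open>c\<close>, so the lifted character is again nontrivial.\<close>
  have c2: "c / 2 \<in> \<F>" using c fixed_by_power_2 fixed_by_power_divide by blast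
  then have "c / 2 + (c / 2) ^ P = c" using frob_exp_two_nonzero[OF P]
    by (simp only: fixed_by_power_def mem_Collect_eq) (simp add: field_simps)
  moreover have "c / 2 \<in> fixed_by_power (P\<^sup>2)" using c2 by (simp only: fixed_by_power_def sq mem_Collect_eq)
  ultimately have "\<exists>x\<in>fixed_by_power (P\<^sup>2). \<psi> (x + x ^ P) \<noteq> 1" using c(2) by metis
  moreover have "\<psi> (x + y + (x + y) ^ P) = \<psi> (x + x ^ P) * \<psi> (y + y ^ P)"
    if "x \<in> fixed_by_power (P\<^sup>2)" "y \<in> fixed_by_power (P\<^sup>2)" for x y
  proof -
    have eq: "x + y + (x + y) ^ P = (x + x ^ P) + (y + y ^ P)" by (simp add: frob_add[OF P])
    show ?thesis unfolding eq using \<psi> tr that unfolding additive_character_def by blast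
  qed
  ultimately show ?thesis using \<psi> tr by (auto simp: additive_character_def)
qed

text \<open>Euler's criterion, read off in the closure: a square root \<open>w\<close> of
  \<open>D\<close> satisfies w^P = D^h * w with h = (P - 1)/2, so for nonzero \<open>w\<close> the
  sign D^h decides whether \<open>w\<close> lies in the subfield.\<close>

lemma card_square_roots:
  assumes D: "D \<in> \<F>"
  shows "D = 0 \<Longrightarrow> card {w\<in>\<F>. w\<^sup>2 = D} = 1"
    and "D ^ ((P - 1) div 2) = 1 \<Longrightarrow> card {w\<in>\<F>. w\<^sup>2 = D} = 2"
    and "D ^ ((P - 1) div 2) = - 1 \<Longrightarrow> card {w\<in>\<F>. w\<^sup>2 = D} = 0"
    and "D \<noteq> 0 \<Longrightarrow> D ^ ((P - 1) div 2) = 1 \<or> D ^ ((P - 1) div 2) = - 1"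
proof -
  obtain h where h: "P = 2 * h + 1" using frob_exp_odd[OF P] by (auto elim: oddE)
  have h0: "h > 0" using frob_exp_gt_1[OF P] h by simp
  have e: "(P - 1) div 2 = h" by (simp add: h)
  obtain w where w: "w ^ 2 = D" using nth_root_exists[of 2 D] by auto
  have wh: "D ^ h * w = w ^ P" unfolding w[symmetric] h by (simp add: power_mult[symmetric])
  have roots: "x\<^sup>2 = D \<longleftrightarrow> x = w \<or> x = - w" for x
    unfolding w[symmetric] by (rule power2_eq_iff)
  have ne: "w \<noteq> - w" if "w \<noteq> 0"
  proof
    assume "w = - w"
    then have "w + w = 0" by (metis add.right_inverse)
    then have "2 * w = 0" by simp
    then show False using that frob_exp_two_nonzero[OF P] by simp
  qed
  show "card {w\<in>\<F>. w\<^sup>2 = D} = 1" if "D = 0"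
  proof -
    have "{w\<in>\<F>. w\<^sup>2 = D} = {0}" using that fixed_by_power_0_1 by auto
    then show ?thesis by simp
  qed
  show "card {w\<in>\<F>. w\<^sup>2 = D} = 2" if "D ^ ((P - 1) div 2) = 1"
  proof -
    have "w \<in> \<F>" using that[unfolded e] wh by (simp add: fixed_by_power_def)
    then have "{w\<in>\<F>. w\<^sup>2 = D} = {w, - w}" unfolding roots using fixed_by_power_minus by auto
    moreover have "w \<noteq> 0" using that[unfolded e] w h0 by (auto simp: zero_power)
    ultimately show ?thesis using ne by simp
  qed
  show "card {w\<in>\<F>. w\<^sup>2 = D} = 0" if "D ^ ((P - 1) div 2) = - 1"
  proof -
    have w0: "w \<noteq> 0" using that[unfolded e] w h0 by (auto simp: zero_power)
    have "x \<notin> \<F>" if "x = w \<or> x = - w" for x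
    proof
      assume "x \<in> \<F>"
      then have "w \<in> \<F>" using that fixed_by_power_minus[of x] by auto
      then have "- w = w" using wh \<open>D ^ ((P - 1) div 2) = - 1\<close>[unfolded e] by (simp add: fixed_by_power_def)
      then show False using ne[OF w0] by simp
    qed
    then have none: "{w\<in>\<F>. w\<^sup>2 = D} = {}" unfolding roots by auto
    show ?thesis unfolding none by simp
  qed
  show "D ^ ((P - 1) div 2) = 1 \<or> D ^ ((P - 1) div 2) = - 1" if "D \<noteq> 0"
  proof -
    have "D ^ h * D ^ h * D = D ^ P" by (simp add: h power_add mult_2)
    then have "D ^ h * D ^ h * D = 1 * D" using D by (simp add: fixed_by_power_def)
    then have "(D ^ h)\<^sup>2 = 1" using that by (simp add: power2_eq_square)
    then show ?thesis unfolding e by (simp add: power2_eq_1_iff)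
  qed
qed

end

section \<open>Quadratic character sums of polynomials\<close>

lemma order_simple_root:
  fixes p :: "'k::field poly"
  assumes "poly p a = 0" "poly (pderiv p) a \<noteq> 0"
  shows "order a p = 1"
proof -
  have "p \<noteq> 0" using assms(2) by auto
  have "\<not> 2 \<le> order a p"
  proof
    assume "2 \<le> order a p"
    then have "[:- a, 1:] ^ 2 dvd p" by (simp add: order_divides)
    then obtain r where "p = [:- a, 1:] * ([:- a, 1:] * r)"
      by (metis dvdE power2_eq_square mult.assoc)
    then have "poly (pderiv p) a = 0" by (simp only: pderiv_mult) (simp add: pderiv_pCons)
    then show False using assms(2) by simp
  qed
  moreover have "order a p \<noteq> 0" using assms(1) \<open>p \<noteq> 0\<close> by (simp add: order_root)
  ultimately show ?thesis by simp
qed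

text \<open>The summand is the quadratic character of the value of \<open>F\<close>. Stepanov's
  method gives upper bounds only, but the points where the character is 1, -1 or 0 exhaust the field
  and at most \<open>D\<close> of them are zeros, so an upper bound for one sign is a lower bound
  for the other.\<close>

lemma quadratic_character_sum_bound:
  fixes F :: "'k::alg_closed_field poly"
  assumes P: "frob_exp TYPE('k) P"
    and F0: "poly F 0 \<noteq> 0" and ord: "order \<rho> F = 1" and D: "degree F = D"
    and h: "P = 2 * h + 1" and large: "2 * D + 2 \<le> h"
    and closed: "\<And>y. y \<in> fixed_by_power (P\<^sup>2) \<Longrightarrow> poly F y \<in> fixed_by_power (P\<^sup>2)"
  shows "\<bar>\<Sum>y\<in>fixed_by_power (P\<^sup>2). real (card {w\<in>fixed_by_power (P\<^sup>2). w\<^sup>2 = poly F y}) - 1\<bar>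
    \<le> (3 * real D + 5) * real P + real D"
proof -
  define E :: "'k set" where "E = fixed_by_power (P\<^sup>2)"
  have P2: "frob_exp TYPE('k) (P\<^sup>2)" by (rule frob_exp_power[OF P]) simp
  have finE: "finite E" and cardE: "card E = P\<^sup>2" using finite_fixed_by_power[OF P2] card_fixed_by_power[OF P2] by (auto simp: E_def)
  define Y where "Y \<epsilon> = {y\<in>E. poly F y ^ ((P\<^sup>2 - 1) div 2) = \<epsilon>}" for \<epsilon>
  define Z where "Z = {y\<in>E. poly F y = 0}"
  have step: "2 * card (Y \<epsilon>) \<le> P\<^sup>2 + (3 * D + 5) * P" if "\<epsilon> \<noteq> 0" for \<epsilon>
    using stepanov[OF P F0 ord D h large that] by (simp add: Y_def E_def fixed_by_power_def)
  have "F \<noteq> 0" using F0 by auto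
  have "card Z \<le> card {y. poly F y = 0}"
    using \<open>F \<noteq> 0\<close> by (intro card_mono poly_roots_finite) (auto simp: Z_def)
  also have "\<dots> \<le> D" using card_poly_roots_bound[OF \<open>F \<noteq> 0\<close>] D by simp
  finally have Z: "card Z \<le> D" .
  have "1 < P\<^sup>2" using frob_exp_gt_1[OF P2] .
  then have "P\<^sup>2 \<ge> 2" by simp
  moreover have "odd (P\<^sup>2)" using frob_exp_odd[OF P2] .
  ultimately have "P\<^sup>2 \<ge> 3" by presburger
  then have exppos: "(P\<^sup>2 - 1) div 2 > 0" by simp
  have ne: "(1::'k) \<noteq> - 1" using frob_exp_two_nonzero[OF P] by (metis add.right_inverse one_add_one)
  have part: "E = Y 1 \<union> Y (- 1) \<union> Z"
    using card_square_roots(4)[OF P2] closed by (auto simp: Y_def Z_def E_def)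
  have disj: "Y 1 \<inter> Y (- 1) = {}" "(Y 1 \<union> Y (- 1)) \<inter> Z = {}"
    using ne exppos by (auto simp: Y_def Z_def zero_power)
  have fin: "finite (Y \<epsilon>)" "finite Z" for \<epsilon> using finE by (auto simp: Y_def Z_def)
  let ?e = "\<lambda>y. real (card {w\<in>E. w\<^sup>2 = poly F y}) - 1"
  have "(\<Sum>y\<in>E. ?e y) = (\<Sum>y\<in>Y 1. ?e y) + (\<Sum>y\<in>Y (- 1). ?e y) + (\<Sum>y\<in>Z. ?e y)"
    by (subst part, subst sum.union_disjoint, use fin disj in simp_all, subst sum.union_disjoint)
       (use fin disj in simp_all)
  also have "(\<Sum>y\<in>Y 1. ?e y) = (\<Sum>y\<in>Y 1. 1)"
    by (intro sum.cong refl, subst E_def, subst card_square_roots(2)[OF P2])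
       (use closed in \<open>auto simp: Y_def E_def\<close>)
  also have "(\<Sum>y\<in>Y (- 1). ?e y) = (\<Sum>y\<in>Y (- 1). - 1)"
    by (intro sum.cong refl, subst E_def, subst card_square_roots(3)[OF P2])
       (use closed in \<open>auto simp: Y_def E_def\<close>)
  also have "(\<Sum>y\<in>Z. ?e y) = (\<Sum>y\<in>Z. 0)"
    by (intro sum.cong refl, subst E_def, subst card_square_roots(1)[OF P2])
       (use fixed_by_power_0_1(1)[OF P2] in \<open>auto simp: Z_def\<close>)
  finally have sum: "(\<Sum>y\<in>E. ?e y) = real (card (Y 1)) - real (card (Y (- 1)))" by simp
  have "card E = card (Y 1) + card (Y (- 1)) + card Z"
    by (subst part, subst card_Un_disjoint, use fin disj in simp_all, subst card_Un_disjoint)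
       (use fin disj in simp_all)
  then have "real (P\<^sup>2) = real (card (Y 1)) + real (card (Y (- 1))) + real (card Z)"
    using cardE by (metis of_nat_add)
  moreover have "2 * real (card (Y \<epsilon>)) \<le> real (P\<^sup>2) + (3 * real D + 5) * real P" if "\<epsilon> \<noteq> 0" for \<epsilon>
  proof -
    have "real (2 * card (Y \<epsilon>)) \<le> real (P\<^sup>2 + (3 * D + 5) * P)" using step[OF that] by (rule of_nat_mono)
    then show ?thesis by simp
  qed
  from this[of 1] this[of "- 1"] have "2 * real (card (Y 1)) \<le> real (P\<^sup>2) + (3 * real D + 5) * real P"
    "2 * real (card (Y (- 1))) \<le> real (P\<^sup>2) + (3 * real D + 5) * real P" by auto
  moreover have "real (card Z) \<le> real D" using Z by simp
  ultimately show ?thesis unfolding E_def[symmetric] sum by linarith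
qed

text \<open>Averaging over the shifts \<open>t \<mapsto> t + y^q - y\<close>, which \<open>\<psi>\<close> does not see, turns the Kloosterman sum into
  quadratic character sums of the polynomials \<open>(Y^q - Y + t)^2 - 4 a\<close>.\<close>

lemma kloosterman_bound_extension:
  fixes \<psi> :: "'k::alg_closed_field \<Rightarrow> complex"
  assumes q: "frob_exp TYPE('k) q" and P: "frob_exp TYPE('k) P"
    and h: "P = 2 * h + 1" and large: "4 * q + 2 \<le> h"
    and \<psi>: "additive_character (fixed_by_power (P\<^sup>2)) \<psi>"
    and inv: "\<And>y. y \<in> fixed_by_power (P\<^sup>2) \<Longrightarrow> \<psi> (y ^ q - y) = 1"
    and a: "a \<in> fixed_by_power (P\<^sup>2)" "a \<noteq> 0"
  shows "norm (kloosterman (fixed_by_power (P\<^sup>2)) \<psi> a) \<le> (8 * real q + 7) * real P"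
proof -
  define E :: "'k set" where "E = fixed_by_power (P\<^sup>2)"
  have P2: "frob_exp TYPE('k) (P\<^sup>2)" by (rule frob_exp_power[OF P]) simp
  have finE: "finite E" and cardE: "card E = P\<^sup>2" using finite_fixed_by_power[OF P2] card_fixed_by_power[OF P2] by (auto simp: E_def)
  note Eclosed = fixed_by_power_add[OF P2, folded E_def] fixed_by_power_diff[OF P2, folded E_def] fixed_by_power_mult[OF P2, folded E_def]
    fixed_by_power_divide[OF P2, folded E_def] fixed_by_power_pow[OF P2, folded E_def] fixed_by_power_minus[OF P2, folded E_def]
    fixed_by_power_2[OF P2, folded E_def] fixed_by_power_4[OF P2, folded E_def]
  have two: "(2::'k) \<noteq> 0" by (rule frob_exp_two_nonzero[OF P])
  then have four: "(4::'k) \<noteq> 0" by (metis mult_2 mult_eq_0_iff numeral_Bit0)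
  have aE: "a \<in> E" using a by (simp add: E_def)
  define r where "r d = card {w\<in>E. w\<^sup>2 = d}" for d
  define g where "g t = t\<^sup>2 - 4 * a" for t
  have gE: "g t \<in> E" if "t \<in> E" for t
    using that aE by (auto simp: g_def intro!: Eclosed)
  \<comment> \<open>Completing the square: for nonzero x, x + a/x = t means that 2 x - t is a square
    root of the discriminant t^2 - 4 a.\<close>
  have card_fibre: "card {x\<in>E - {0}. x + a / x = t} = r (g t)" if t: "t \<in> E" for t
    unfolding r_def
  proof (rule bij_betw_same_card[of "\<lambda>x. 2 * x - t"], rule bij_betw_byWitness[of _ "\<lambda>w. (w + t) / 2"])
    show "\<forall>x\<in>{x\<in>E - {0}. x + a / x = t}. (2 * x - t + t) / 2 = x" using two by simp
    show "\<forall>w\<in>{w\<in>E. w\<^sup>2 = g t}. 2 * ((w + t) / 2) - t = w" using two by (simp del: distrib_left_numeral)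
    show "(\<lambda>x. 2 * x - t) ` {x\<in>E - {0}. x + a / x = t} \<subseteq> {w\<in>E. w\<^sup>2 = g t}"
    proof (rule image_subsetI)
      fix x assume "x \<in> {x\<in>E - {0}. x + a / x = t}"
      then have x: "x \<in> E" "x \<noteq> 0" "t = x + a / x" by auto
      have "2 * x - t \<in> E" using x(1) t by (auto intro!: Eclosed)
      moreover have "(2 * x - t)\<^sup>2 = g t"
        using x(2) unfolding x(3) by (simp add: g_def power2_eq_square field_simps)
      ultimately show "2 * x - t \<in> {w\<in>E. w\<^sup>2 = g t}" by simp
    qed
    show "(\<lambda>w. (w + t) / 2) ` {w\<in>E. w\<^sup>2 = g t} \<subseteq> {x\<in>E - {0}. x + a / x = t}"
    proof (rule image_subsetI)
      fix w assume "w \<in> {w\<in>E. w\<^sup>2 = g t}"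
      then have w: "w \<in> E" "w\<^sup>2 = t\<^sup>2 - 4 * a" by (auto simp: g_def)
      define x where "x = (w + t) / 2"
      have wx: "w = 2 * x - t" using two by (simp add: x_def del: distrib_left_numeral)
      have "4 * (x * x + a) = 4 * (t * x)" using w(2) unfolding wx by (simp add: power2_eq_square algebra_simps)
      then have xx: "x * x + a = t * x" using mult_left_cancel[OF four] by blast
      then have "x \<noteq> 0" using a(2) by auto
      then have "x + a / x = t" using xx by (simp add: field_simps)
      moreover have "x \<in> E" unfolding x_def using w t by (auto intro!: Eclosed)
      ultimately show "(w + t) / 2 \<in> {x\<in>E - {0}. x + a / x = t}" using \<open>x \<noteq> 0\<close> by (simp add: x_def[symmetric])
    qed
  qed
  define K where "K = kloosterman E \<psi> a"
  have "K = (\<Sum>t\<in>E. of_nat (card {x\<in>E - {0}. x + a / x = t}) * \<psi> t)"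
    unfolding K_def kloosterman_def
    by (intro sum_by_fibres) (use finE aE in \<open>auto intro!: Eclosed\<close>)
  also have "\<dots> = (\<Sum>t\<in>E. of_nat (r (g t)) * \<psi> t)"
    using card_fibre by (intro sum.cong) auto
  \<comment> \<open>Subtracting 1 turns the number of square roots into the quadratic character, and
    costs nothing since \<psi> sums to zero.\<close>
  also have "\<dots> = (\<Sum>t\<in>E. \<psi> t * of_real (real (r (g t)) - 1)) + (\<Sum>t\<in>E. \<psi> t)"
    by (simp add: sum.distrib[symmetric] algebra_simps)
  also have "(\<Sum>t\<in>E. \<psi> t) = 0"
    using sum_character_zero[OF finE _ _ \<psi>[folded E_def]] Eclosed by blast
  finally have K: "K = (\<Sum>t\<in>E. \<psi> t * of_real (real (r (g t)) - 1))" by simp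
  have yE: "y ^ q - y \<in> E" if "y \<in> E" for y using that by (auto intro!: Eclosed)
  have shift: "K = (\<Sum>t\<in>E. \<psi> t * of_real (real (r (g (t + (y ^ q - y)))) - 1))" if y: "y \<in> E" for y
  proof -
    have "K = (\<Sum>t\<in>E. \<psi> (t + (y ^ q - y)) * of_real (real (r (g (t + (y ^ q - y)))) - 1))"
      unfolding K
      by (rule sum.reindex_bij_witness[of _ "\<lambda>t. t + (y ^ q - y)" "\<lambda>t. t - (y ^ q - y)"])
         (use yE[OF y] Eclosed in auto)
    also have "\<dots> = (\<Sum>t\<in>E. \<psi> t * of_real (real (r (g (t + (y ^ q - y)))) - 1))"
    proof (rule sum.cong)
      fix t assume "t \<in> E"
      then have "\<psi> (t + (y ^ q - y)) = \<psi> t"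
        using \<psi> inv[folded E_def, OF y] yE[OF y] by (simp add: additive_character_def E_def)
      then show "\<psi> (t + (y ^ q - y)) * of_real (real (r (g (t + (y ^ q - y)))) - 1)
          = \<psi> t * of_real (real (r (g (t + (y ^ q - y)))) - 1)" by simp
    qed simp
    finally show ?thesis .
  qed
  define W where "W t = (\<Sum>y\<in>E. real (r (g (t + (y ^ q - y)))) - 1)" for t
  have "of_nat (P\<^sup>2) * K = (\<Sum>y\<in>E. K)" by (simp add: cardE)
  also have "\<dots> = (\<Sum>y\<in>E. \<Sum>t\<in>E. \<psi> t * of_real (real (r (g (t + (y ^ q - y)))) - 1))"
    using shift by (intro sum.cong) auto
  also have "\<dots> = (\<Sum>t\<in>E. \<psi> t * of_real (W t))"
    by (subst sum.swap) (simp add: W_def sum_distrib_left)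
  finally have PK: "of_nat (P\<^sup>2) * K = (\<Sum>t\<in>E. \<psi> t * of_real (W t))" .
  define C where "C = (3 * real (2 * q) + 5) * real P + real (2 * q)"
  have C0: "C \<ge> 0" by (simp add: C_def)
  \<comment> \<open>The polynomial \<open>F\<close> below takes the value \<open>g t\<close> at 0,
    and the non-vanishing argument needs this to be nonzero. The at most two exceptional
    \<open>t\<close> are left to the trivial bound.\<close>
  have generic: "\<bar>W t\<bar> \<le> C" if t: "t \<in> E" "g t \<noteq> 0" for t
  proof -
    define u :: "'k poly" where "u = monom 1 q - monom 1 1 + [:t:]"
    define F where "F = u\<^sup>2 - [:4 * a:]"
    have degu: "degree u = q"
    proof -
      have "degree (- monom 1 1 + [:t:]) \<le> 1" by (intro degree_add_le) (auto simp: degree_monom_eq)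
      then have "degree (monom 1 q + (- monom 1 1 + [:t:])) = q"
        using frob_exp_gt_1[OF q] by (subst degree_add_eq_left) (auto simp: degree_monom_eq)
      then show ?thesis by (simp add: u_def algebra_simps)
    qed
    have degF: "degree F = 2 * q"
    proof -
      have "u \<noteq> 0" using degu frob_exp_gt_1[OF q] by auto
      then have "degree (u\<^sup>2) = 2 * q" by (simp add: power2_eq_square degree_mult_eq degu)
      then have "degree (u\<^sup>2 + (- [:4 * a:])) = 2 * q"
        using frob_exp_gt_1[OF q] by (subst degree_add_eq_left) auto
      then show ?thesis by (simp only: F_def add_uminus_conv_diff)
    qed
    have polyF: "poly F y = g (t + (y ^ q - y))" for y
      by (simp add: F_def u_def g_def poly_monom algebra_simps)
    obtain \<rho> where \<rho>: "poly F \<rho> = 0"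
      using alg_closed_imp_poly_has_root[of F] degF frob_exp_gt_1[OF q] by auto
    \<comment> \<open>Since q vanishes in the field, \<open>u\<close> has constant derivative and
      that of \<open>F\<close> is -2 \<open>u\<close>. At a root of \<open>F\<close> the square of
      \<open>u\<close> is 4 a, which is nonzero, so the root is simple.\<close>
    have "pderiv u = - 1"
      using q by (simp add: u_def frob_exp_def pderiv_add pderiv_diff pderiv_monom pderiv_pCons monom_0 one_pCons)
    then have "poly (pderiv F) \<rho> = - (2 * poly u \<rho>)"
      by (simp add: F_def power2_eq_square pderiv_mult pderiv_diff pderiv_pCons)
    moreover have "poly u \<rho> ^ 2 = 4 * a" using \<rho> by (simp add: F_def)
    ultimately have "poly (pderiv F) \<rho> \<noteq> 0" using a two four by auto
    with \<rho> have ord: "order \<rho> F = 1" by (rule order_simple_root)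
    have "\<bar>\<Sum>y\<in>E. real (card {w\<in>E. w\<^sup>2 = poly F y}) - 1\<bar> \<le> C"
      unfolding C_def E_def
    proof (rule quadratic_character_sum_bound[OF P _ ord degF h])
      show "poly F 0 \<noteq> 0" using t(2) frob_exp_pos[OF q] by (simp add: polyF zero_power)
      show "2 * (2 * q) + 2 \<le> h" using large by simp
      show "poly F y \<in> fixed_by_power (P\<^sup>2)" if "y \<in> fixed_by_power (P\<^sup>2)" for y
        using gE[of "t + (y ^ q - y)"] yE[of y] that t(1) Eclosed(1) unfolding polyF E_def by blast
    qed
    then show ?thesis by (simp add: W_def r_def polyF)
  qed
  have trivial: "\<bar>W t\<bar> \<le> real (P\<^sup>2)" if "t \<in> E" for t
  proof -
    have "\<bar>real (r (g (t + (y ^ q - y)))) - 1\<bar> \<le> 1" if "y \<in> E" for y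
    proof -
      have "g (t + (y ^ q - y)) \<in> E" using \<open>t \<in> E\<close> yE[OF that] Eclosed(1) gE by blast
      from card_square_roots[OF P2 this[unfolded E_def], folded E_def] show ?thesis
        by (fold r_def) fastforce
    qed
    then have "\<bar>W t\<bar> \<le> (\<Sum>y\<in>E. 1)" unfolding W_def by (intro order_trans[OF sum_abs] sum_mono)
    then show ?thesis by (simp add: cardE)
  qed
  define Z where "Z = {t\<in>E. g t = 0}"
  have Z: "card Z \<le> 2"
  proof -
    have "4 * a \<in> E" using aE by (auto intro!: Eclosed)
    from card_square_roots[OF P2 this[unfolded E_def], folded E_def]
    have "card {w\<in>E. w\<^sup>2 = 4 * a} \<le> 2" by fastforce
    then show ?thesis by (simp add: Z_def g_def)
  qed
  have "real (P\<^sup>2) * norm K = norm (\<Sum>t\<in>E. \<psi> t * of_real (W t))"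
    unfolding PK[symmetric] norm_mult norm_of_nat by (rule refl)
  also have "\<dots> \<le> (\<Sum>t\<in>E. \<bar>W t\<bar>)"
    by (intro sum_norm_le) (use \<psi> in \<open>auto simp: norm_mult additive_character_def E_def\<close>)
  also have "\<dots> \<le> (\<Sum>t\<in>E. C + (if g t = 0 then real (P\<^sup>2) else 0))"
    using generic trivial C0 by (intro sum_mono) (auto intro: add_increasing)
  also have "\<dots> = real (P\<^sup>2) * C + real (card Z) * real (P\<^sup>2)"
    using finE by (simp add: sum.distrib cardE Z_def sum.If_cases Int_def)
  also have "\<dots> \<le> real (P\<^sup>2) * (C + 2)"
    using Z by (simp add: algebra_simps mult_right_mono)
  finally have "norm K \<le> C + 2" using frob_exp_pos[OF P] by simp
  also have "\<dots> \<le> (8 * real q + 7) * real P"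
  proof -
    have "real P \<ge> 1" using frob_exp_pos[OF P] by simp
    then have "(2 * real q + 2) * 1 \<le> (2 * real q + 2) * real P" by (intro mult_left_mono) auto
    then show ?thesis by (simp add: C_def algebra_simps)
  qed
  finally show ?thesis by (simp add: K_def E_def)
qed

section \<open>The tower of quadratic extensions and Weil's bound\<close>

lemma bounded_quadratic_recursion:
  fixes u :: "nat \<Rightarrow> real"
  assumes rec: "\<And>n. (u n)\<^sup>2 - 2 \<le> u (Suc n)" and bdd: "\<And>n. n \<ge> N \<Longrightarrow> u n \<le> C"
  shows "u 0 \<le> 2"
proof (rule ccontr)
  assume "\<not> u 0 \<le> 2"
  then have e: "u 0 - 2 > 0" by simp
  define e where "e = u 0 - 2"
  \<comment> \<open>2 is a repelling fixed point of x^2 - 2: an excess e over it becomes 4 e + e^2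
    in one step.\<close>
  have grow: "u n \<ge> 2 + 4 ^ n * e" for n
  proof (induction n)
    case (Suc n)
    have "0 \<le> 4 ^ n * e" using e by (simp add: e_def)
    then have "(2 + 4 ^ n * e)\<^sup>2 \<le> (u n)\<^sup>2" using Suc by (intro power_mono) auto
    moreover have "(2 + 4 ^ n * e)\<^sup>2 = 4 + 4 ^ Suc n * e + (4 ^ n * e)\<^sup>2"
      by (simp add: power2_eq_square algebra_simps)
    ultimately show ?case using rec[of n] zero_le_power2[of "4 ^ n * e"] by linarith
  qed (simp add: e_def)
  obtain n where n: "C / e < real n" using reals_Archimedean2 by blast
  define m where "m = max n N"
  have "real n \<le> 4 ^ m"
  proof -
    have "n \<le> m" by (simp add: m_def)
    also have "m \<le> 2 ^ m" by simp
    also have "(2::nat) ^ m \<le> 4 ^ m" by (intro power_mono) auto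
    finally show ?thesis by (metis of_nat_le_iff of_nat_numeral of_nat_power)
  qed
  with n have "C / e < 4 ^ m" by linarith
  then have "C < 4 ^ m * e" using e by (simp add: e_def pos_divide_less_eq)
  with grow[of m] bdd[of m] show False by (simp add: m_def)
qed

text \<open>The composition of \<open>\<psi>\<close> with the trace from the field with q^(2^n)
  elements down to the base field, built one quadratic step at a time.\<close>

primrec lifted_character :: "nat \<Rightarrow> ('k::field \<Rightarrow> complex) \<Rightarrow> nat \<Rightarrow> 'k \<Rightarrow> complex" where
  "lifted_character q \<psi> 0 = \<psi>"
| "lifted_character q \<psi> (Suc n) = (\<lambda>x. lifted_character q \<psi> n (x + x ^ (q ^ 2 ^ n)))"

theorem kloosterman_weil_bound:
  fixes \<psi> :: "'k::alg_closed_field \<Rightarrow> complex"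
  assumes q: "frob_exp TYPE('k) q" and \<psi>: "additive_character (fixed_by_power q) \<psi>"
    and a: "a \<in> fixed_by_power q" "a \<noteq> 0"
  shows "norm (kloosterman (fixed_by_power q) \<psi> a) \<le> 2 * sqrt q"
proof -
  define Q where "Q n = q ^ 2 ^ n" for n :: nat
  have Q0: "Q 0 = q" by (simp add: Q_def)
  have QSuc: "Q (Suc n) = (Q n)\<^sup>2" for n by (simp only: Q_def power_Suc2 power_mult)
  have Q: "frob_exp TYPE('k) (Q n)" for n unfolding Q_def by (rule frob_exp_power[OF q]) simp
  have sq: "x ^ (Q n)\<^sup>2 = (x ^ Q n) ^ Q n" for x :: 'k and n by (simp add: power2_eq_square power_mult)
  define \<Psi> where "\<Psi> = lifted_character q \<psi>"
  have \<Psi>0: "\<Psi> 0 = \<psi>" and \<Psi>Suc: "\<Psi> (Suc n) = (\<lambda>x. \<Psi> n (x + x ^ Q n))" for n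
    by (simp_all add: \<Psi>_def Q_def)
  have char: "additive_character (fixed_by_power (Q n)) (\<Psi> n)" for n
  proof (induction n)
    case (Suc n)
    then show ?case unfolding QSuc \<Psi>Suc by (rule quadratic_extension_character[OF Q])
  qed (simp add: Q0 \<Psi>0 \<psi>)
  have aQ: "a \<in> fixed_by_power (Q n)" for n
  proof (induction n)
    case (Suc n)
    then show ?case unfolding QSuc fixed_by_power_def by (simp add: sq)
  qed (simp add: Q0 a)
  \<comment> \<open>The trace commutes with Frobenius and so kills y^q - y: each step down turns it
    into z^q - z with z in the smaller field, and at the bottom y^q = y.\<close>
  have inv: "\<Psi> n (y ^ q - y) = 1" if "y \<in> fixed_by_power (Q n)" for n y
    using that
  proof (induction n arbitrary: y)
    case 0
    then have "y ^ q - y = 0" by (simp add: fixed_by_power_def Q0)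
    moreover have "\<psi> (0 + 0) = \<psi> 0 * \<psi> 0" "norm (\<psi> 0) = 1"
      using \<psi> fixed_by_power_0_1[OF q] unfolding additive_character_def by blast+
    ultimately show ?case by (metis \<Psi>0 add_0 mult_cancel_right1 norm_zero zero_neq_one)
  next
    case (Suc n)
    define z where "z = y + y ^ Q n"
    have "z \<in> fixed_by_power (Q n)"
      using Suc.prems by (simp add: z_def QSuc fixed_by_power_def frob_add[OF Q] sq add.commute)
    moreover have "(y ^ q) ^ Q n = (y ^ Q n) ^ q" by (metis power_mult mult.commute)
    then have "y ^ q - y + (y ^ q - y) ^ Q n = z ^ q - z"
      by (simp add: z_def frob_diff[OF Q] frob_add[OF q])
    ultimately show ?case unfolding \<Psi>Suc using Suc.IH by simp
  qed
  define K where "K n = kloosterman (fixed_by_power (Q n)) (\<Psi> n) a" for n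
  have Krec: "K (Suc n) = 2 * of_nat (Q n) - (K n)\<^sup>2" for n
    unfolding K_def QSuc \<Psi>Suc by (rule kloosterman_quadratic_extension[OF Q char aQ a(2)])
  \<comment> \<open>Normalised so that Weil's bound at the bottom level reads \<open>u 0\<close>
    \<le> 2.\<close>
  define u where "u n = norm (K n) / sqrt (Q n)" for n
  have Qpos: "Q n > 0" for n using frob_exp_pos[OF Q] .
  have "u 0 \<le> 2"
  proof (rule bounded_quadratic_recursion)
    fix n
    have "(K n)\<^sup>2 = 2 * of_nat (Q n) - K (Suc n)" by (simp add: Krec)
    then have "norm (K n) ^ 2 \<le> 2 * real (Q n) + norm (K (Suc n))"
      by (metis (no_types, lifting) norm_power norm_triangle_ineq4 norm_mult norm_numeral norm_of_nat)
    then have "norm (K n) ^ 2 / real (Q n) \<le> (2 * real (Q n) + norm (K (Suc n))) / real (Q n)"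
      by (rule divide_right_mono) simp
    then show "(u n)\<^sup>2 - 2 \<le> u (Suc n)"
      using Qpos[of n] by (simp add: u_def QSuc power_divide add_divide_distrib)
  next
    \<comment> \<open>Stepanov's method needs Q m \<ge> 8 q + 5 at the level m just below n; as Q m
      exceeds m, all levels from 8 q + 6 on are safe.\<close>
    fix n assume n: "n \<ge> 8 * q + 6"
    then obtain m where m: "n = Suc m" "m \<ge> 8 * q + 5" by (cases n) auto
    obtain h where h: "Q m = 2 * h + 1" using frob_exp_odd[OF Q, of m] by (auto elim: oddE)
    have "m < 2 ^ m" by simp
    also have "(2::nat) ^ m < 2 ^ (2 ^ m)" by simp
    also have "(2::nat) ^ (2 ^ m) \<le> Q m" unfolding Q_def using frob_exp_gt_1[OF q] by (intro power_mono) auto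
    finally have "4 * q + 2 \<le> h" using m h by simp
    then have "norm (K n) \<le> (8 * real q + 7) * real (Q m)"
      unfolding K_def m QSuc
      using kloosterman_bound_extension[OF q Q h, of "\<Psi> (Suc m)" a] char[of "Suc m"] inv[of _ "Suc m"] aQ[of "Suc m"] a(2)
      unfolding QSuc by blast
    then show "u n \<le> 8 * real q + 7" using Qpos[of m] by (simp add: u_def m QSuc field_simps)
  qed
  then show ?thesis using Qpos[of 0] by (simp add: u_def K_def Q0 \<Psi>0 field_simps)
qed

section \<open>Finite fields inside their algebraic closure\<close>

lemma power_card_eq_self:
  fixes x :: "'a::{field,finite}"
  shows "x ^ CARD('a) = x"
proof (cases "x = 0")
  case False
  have "(\<Prod>y\<in>UNIV - {0}. y) = (\<Prod>y\<in>UNIV - {0}. x * y)"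
    by (rule prod.reindex_bij_witness[of _ "\<lambda>y. x * y" "\<lambda>y. y / x"]) (use False in auto)
  also have "\<dots> = x ^ (CARD('a) - 1) * (\<Prod>y\<in>UNIV - {0}. y)" by (simp add: prod.distrib card_Diff_singleton)
  finally have "x ^ (CARD('a) - 1) = 1" by simp
  moreover have "x ^ CARD('a) = x * x ^ (CARD('a) - 1)"
    by (metis finite_UNIV_card_ge_0 finite power_minus_mult mult.commute)
  ultimately show ?thesis by simp
qed (simp add: zero_power)

lemma of_nat_card_eq_zero: "of_nat CARD('a) = (0::'a::{ring_1,finite})"
proof -
  have "(\<Sum>x\<in>UNIV. x) = (\<Sum>x\<in>UNIV. x + (1::'a))"
    by (rule sum.reindex_bij_witness[of _ "\<lambda>x. x + 1" "\<lambda>x. x - 1"]) auto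
  then show ?thesis by (simp add: sum.distrib)
qed

lemma card_field_ge_2: "CARD('a::{field,finite}) \<ge> 2"
proof -
  have "card {0, 1::'a} \<le> CARD('a)" by (intro card_mono) auto
  then show ?thesis by simp
qed

text \<open>\<open>(X + 1)^q - X^q - 1\<close> has degree less than \<open>q\<close> but vanishes on the whole field with \<open>q\<close> elements.\<close>

lemma of_nat_card_choose_eq_zero:
  assumes "0 < k" "k < CARD('a)"
  shows "of_nat (CARD('a) choose k) = (0::'a::{field,finite})"
proof -
  define q where "q = CARD('a)"
  have q: "q \<ge> 2" using card_field_ge_2 by (simp add: q_def)
  define p :: "'a poly" where "p = (\<Sum>k\<in>{1..<q}. monom (of_nat (q choose k)) k)"
  have root: "poly p x = 0" for x
  proof -
    have "(x + 1) ^ q = (\<Sum>k\<le>q. of_nat (q choose k) * x ^ k)" by (simp add: binomial_ring)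
    also have "{..q} = insert 0 (insert q {1..<q})" using q by auto
    also have "(\<Sum>k\<in>insert 0 (insert q {1..<q}). of_nat (q choose k) * x ^ k) = 1 + (x ^ q + poly p x)"
      using q by (simp add: p_def poly_sum poly_monom)
    finally show ?thesis by (simp add: q_def power_card_eq_self)
  qed
  have "p = 0"
  proof (rule ccontr)
    assume "p \<noteq> 0"
    have "card {x. poly p x = 0} \<le> degree p" using card_poly_roots_bound[OF \<open>p \<noteq> 0\<close>] .
    also have "degree p \<le> q - 1" unfolding p_def
      by (intro degree_sum_le) (auto intro: order_trans[OF degree_monom_le])
    finally show False using root q by (simp add: q_def)
  qed
  moreover have "coeff p k = of_nat (q choose k)"
    using assms by (simp add: p_def coeff_sum q_def)
  ultimately show ?thesis by (simp add: q_def)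
qed

text \<open>Additivity of the power map on the closure only asks that the middle binomial
  coefficients vanish there, and they already vanish in the finite field.\<close>

lemma frob_exp_card:
  assumes "odd CARD('a::{field,finite})"
  shows "frob_exp TYPE('a alg_closure) CARD('a)"
proof -
  define q where "q = CARD('a)"
  have q: "q \<ge> 2" using card_field_ge_2 by (simp add: q_def)
  have "(x + y) ^ q = x ^ q + y ^ q" for x y :: "'a alg_closure"
  proof -
    have "of_nat (q choose k) = (0::'a alg_closure)" if "k \<in> {1..<q}" for k
      using of_nat_card_choose_eq_zero[where 'a='a, of k] that
      by (metis atLeastLessThan_iff less_eq_Suc_le One_nat_def q_def to_ac_0 to_ac_of_nat)
    then have z: "(\<Sum>k\<in>{1..<q}. of_nat (q choose k) * x ^ k * y ^ (q - k)) = 0"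
      by (intro sum.neutral) auto
    have "(x + y) ^ q = (\<Sum>k\<le>q. of_nat (q choose k) * x ^ k * y ^ (q - k))" by (rule binomial_ring)
    also have "{..q} = insert 0 (insert q {1..<q})" using q by auto
    finally show ?thesis using q z by (simp add: add.commute)
  qed
  moreover have "of_nat q = (0::'a alg_closure)"
    by (metis of_nat_card_eq_zero q_def to_ac_0 to_ac_of_nat)
  ultimately show ?thesis using assms q by (simp add: frob_exp_def q_def)
qed

text \<open>One inclusion is Fermat's identity; equality follows because both sides have as many
  elements as the field.\<close>

lemma range_to_ac:
  assumes "odd CARD('a::{field,finite})"
  shows "range (to_ac :: 'a \<Rightarrow> 'a alg_closure) = fixed_by_power CARD('a)"
proof (rule card_subset_eq)
  show "finite (fixed_by_power CARD('a) :: 'a alg_closure set)" by (rule finite_fixed_by_power[OF frob_exp_card[OF assms]])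
  show "range (to_ac :: 'a \<Rightarrow> 'a alg_closure) \<subseteq> fixed_by_power CARD('a)"
    by (auto simp: fixed_by_power_def power_card_eq_self simp flip: to_ac_power)
  show "card (range (to_ac :: 'a \<Rightarrow> 'a alg_closure)) = card (fixed_by_power CARD('a) :: 'a alg_closure set)"
    by (simp add: card_fixed_by_power[OF frob_exp_card[OF assms]] card_image inj_to_ac)
qed

lemma kloosterman_bound:
  fixes a :: "'a::{field,finite}"
  assumes odd: "odd CARD('a)" and \<psi>: "additive_character UNIV \<psi>" and a: "a \<noteq> 0"
  shows "norm (kloosterman UNIV \<psi> a) \<le> 2 * sqrt CARD('a)"
proof -
  define E :: "'a alg_closure set" where "E = fixed_by_power CARD('a)"
  have E: "E = range to_ac" using range_to_ac[OF odd] by (simp add: E_def)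
  define \<Psi> where "\<Psi> x = \<psi> (of_ac x)" for x
  have \<Psi>: "\<Psi> (to_ac x) = \<psi> x" for x by (simp add: \<Psi>_def)
  have "\<Psi> (to_ac x + to_ac y) = \<Psi> (to_ac x) * \<Psi> (to_ac y)" for x y
    using \<psi> by (simp add: \<Psi> additive_character_def flip: to_ac_add)
  then have char: "additive_character E \<Psi>"
    using \<psi> by (auto simp: E additive_character_def \<Psi>)
  have "norm (kloosterman E \<Psi> (to_ac a)) \<le> 2 * sqrt CARD('a)"
    unfolding E_def
    by (rule kloosterman_weil_bound[OF frob_exp_card[OF odd] char[unfolded E_def]])
       (use a E in \<open>auto simp: E_def[symmetric]\<close>)
  also have "kloosterman E \<Psi> (to_ac a) = kloosterman UNIV \<psi> a"
    unfolding kloosterman_def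
    by (rule sum.reindex_bij_witness[of _ to_ac of_ac])
       (auto simp: E \<Psi> simp flip: to_ac_divide to_ac_add)
  finally show ?thesis .
qed

section \<open>Gauss sums and Salie sums\<close>

text \<open>A largest additive subgroup \<open>M\<close> avoiding 1 is a complement of the prime
  field. The character is the projection along \<open>M\<close> followed by an exponential of order
  \<open>p\<close>; this takes the place of the trace to the prime field.\<close>

lemma exists_additive_character: "\<exists>\<psi>. additive_character (UNIV :: 'a::{field,finite} set) \<psi>"
proof -
  define p where "p = CHAR('a)"
  have p: "prime p" unfolding p_def
    by (rule prime_CHAR_semidom) (rule finite_imp_CHAR_pos, simp)
  have p0: "of_nat m = (0::'a) \<longleftrightarrow> p dvd m" for m by (simp add: p_def of_nat_eq_0_iff_char_dvd)
  define good where "good M \<longleftrightarrow> 0 \<in> M \<and> (\<forall>x\<in>M. \<forall>y\<in>M. x - y \<in> M) \<and> (1::'a) \<notin> M" for M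
  have "good {0}" by (simp add: good_def)
  then obtain M where M: "good M" and max: "\<And>N. good N \<Longrightarrow> card N \<le> card M"
    using ex_has_greatest_nat[of good "{0}" card "Suc CARD('a)"] by (metis card_mono finite less_Suc_eq_le subset_UNIV)
  have M0: "0 \<in> M" and Mdiff: "\<And>x y. x \<in> M \<Longrightarrow> y \<in> M \<Longrightarrow> x - y \<in> M" and M1: "1 \<notin> M"
    using M by (auto simp: good_def)
  have Mneg: "- x \<in> M" if "x \<in> M" for x using Mdiff[OF M0 that] by simp
  have Madd: "x + y \<in> M" if "x \<in> M" "y \<in> M" for x y using Mdiff[OF that(1) Mneg[OF that(2)]] by simp
  have Mmult: "of_nat k * x \<in> M" if "x \<in> M" for k x
    using that by (induction k) (auto simp: M0 algebra_simps intro: Madd)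
  have nat_neg: "\<exists>k. of_nat k = - (of_nat j :: 'a)" for j
  proof -
    have "j * (p - 1) + j = j * p" using prime_gt_0_nat[OF p] by (cases p) auto
    then have "of_nat (j * (p - 1)) + (of_nat j :: 'a) = of_nat (j * p)" by (metis of_nat_add)
    also have "\<dots> = 0" by (simp add: p0 del: of_nat_mult)
    finally show ?thesis unfolding add_eq_0_iff2 by blast
  qed
  have inverse: "\<exists>k. of_nat (k * j) = (1::'a)" if "\<not> p dvd j" for j
  proof -
    have "coprime j p" using p that by (metis coprime_commute prime_imp_coprime)
    then obtain k where "[j * k = Suc 0] (mod p)" using cong_solve_coprime_nat by blast
    then have "of_nat (j * k) = (of_nat (Suc 0) :: 'a)"
      unfolding p_def by (simp only: of_nat_eq_iff_cong_CHAR)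
    then show ?thesis by (intro exI[of _ k]) (simp add: mult.commute)
  qed
  \<comment> \<open>If \<open>x\<close> is outside \<open>M\<close>, then by maximality
    \<open>M\<close> and the multiples of \<open>x\<close> together generate 1. So 1 = m + j x with
    j invertible modulo \<open>p\<close>, and this is solved for \<open>x\<close>.\<close>
  have reach: "\<exists>j. x - of_nat j \<in> M" for x
  proof (cases "x \<in> M")
    case True
    then show ?thesis by (intro exI[of _ 0]) simp
  next
    case False
    define N where "N = {m + of_nat j * x | m j. m \<in> M}"
    have sub: "M \<subseteq> N" unfolding N_def by (force intro: exI[of _ "0::nat"])
    have "x \<in> N" unfolding N_def using M0 by (force intro: exI[of _ "1::nat"])
    with False sub have "card M < card N" by (intro psubset_card_mono) auto
    then have "\<not> good N" using max[of N] by auto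
    moreover have "0 \<in> N" using sub M0 by auto
    moreover have "u - v \<in> N" if uv: "u \<in> N" "v \<in> N" for u v
    proof -
      from uv obtain m j m' j' where mj: "u = m + of_nat j * x" "m \<in> M" "v = m' + of_nat j' * x" "m' \<in> M"
        by (auto simp: N_def)
      obtain k where k: "of_nat k = - (of_nat j' :: 'a)" using nat_neg by blast
      have "u - v = (m - m') + of_nat (j + k) * x" by (simp add: mj k algebra_simps)
      then show ?thesis unfolding N_def using Mdiff[OF mj(2,4)] by blast
    qed
    ultimately have "1 \<in> N" by (auto simp: good_def)
    then obtain m j where mj: "1 = m + of_nat j * x" "m \<in> M" by (auto simp: N_def)
    have "\<not> p dvd j"
    proof
      assume "p dvd j"
      then have "of_nat j = (0::'a)" by (simp add: p0)
      with mj M1 show False by simp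
    qed
    then obtain k where "of_nat (k * j) = (1::'a)" using inverse by blast
    then have "x = of_nat k * (of_nat j * x)" by (simp add: mult.assoc[symmetric])
    also have "of_nat j * x = 1 - m" using mj by (simp add: algebra_simps)
    finally have "x - of_nat k = - (of_nat k * m)" by (simp add: algebra_simps)
    then show ?thesis using Mneg[OF Mmult[OF mj(2)]] by metis
  qed
  \<comment> \<open>Otherwise i - j is invertible modulo \<open>p\<close>, and a multiple of it
    would put 1 into \<open>M\<close>.\<close>
  have unique: "[i = j] (mod p)" if "of_nat i - (of_nat j :: 'a) \<in> M" for i j
  proof (rule ccontr)
    assume ne: "\<not> [i = j] (mod p)"
    obtain k where k: "of_nat k = - (of_nat j :: 'a)" using nat_neg by blast
    have ik: "of_nat (i + k) = of_nat i - (of_nat j :: 'a)" by (simp add: k)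
    have "\<not> p dvd i + k"
    proof
      assume "p dvd i + k"
      then have "of_nat i - (of_nat j :: 'a) = 0" using ik p0 by metis
      then show False using ne unfolding p_def by (simp add: of_nat_eq_iff_cong_CHAR)
    qed
    then obtain l where l: "of_nat (l * (i + k)) = (1::'a)" using inverse by blast
    have "of_nat l * of_nat (i + k) \<in> M" unfolding ik by (rule Mmult[OF that])
    with l M1 show False by simp
  qed
  define idx where "idx x = (SOME j. x - of_nat j \<in> M)" for x
  have idx: "x - of_nat (idx x) \<in> M" for x unfolding idx_def using reach by (rule someI_ex)
  define \<zeta> where "\<zeta> j = cis (2 * pi * real j / real p)" for j :: nat
  have \<zeta>_add: "\<zeta> (i + j) = \<zeta> i * \<zeta> j" for i j
    by (simp add: \<zeta>_def cis_mult add_divide_distrib algebra_simps)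
  have p0': "real p \<noteq> 0" using p prime_gt_0_nat[of p] by simp
  have \<zeta>_period: "\<zeta> (p * k) = 1" for k
  proof -
    have "2 * pi * real (p * k) / real p = 2 * pi * real k" using p0' by simp
    then show ?thesis unfolding \<zeta>_def by (simp add: cis_multiple_2pi)
  qed
  have \<zeta>_mod: "\<zeta> (j mod p) = \<zeta> j" for j
    using \<zeta>_add[of "p * (j div p)" "j mod p"] by (simp add: \<zeta>_period)
  have \<zeta>_cong: "\<zeta> i = \<zeta> j" if "[i = j] (mod p)" for i j
    using \<zeta>_mod[of i] \<zeta>_mod[of j] that by (simp add: Cong.cong_def)
  define \<psi> where "\<psi> x = \<zeta> (idx x)" for x
  have \<psi>eq: "\<psi> x = \<zeta> j" if "x - of_nat j \<in> M" for x j
  proof -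
    have "of_nat (idx x) - (of_nat j :: 'a) \<in> M" using Mdiff[OF that idx[of x]] by simp
    then show ?thesis unfolding \<psi>_def by (intro \<zeta>_cong unique)
  qed
  have "\<psi> (x + y) = \<psi> x * \<psi> y" for x y
  proof -
    have "x + y - of_nat (idx x + idx y) \<in> M" using Madd[OF idx[of x] idx[of y]] by (simp add: algebra_simps)
    then have "\<psi> (x + y) = \<zeta> (idx x + idx y)" by (rule \<psi>eq)
    then show ?thesis by (simp add: \<zeta>_add \<psi>_def)
  qed
  moreover have "norm (\<psi> x) = 1" for x by (simp add: \<psi>_def \<zeta>_def)
  moreover have "\<psi> 1 \<noteq> 1"
  proof -
    have "\<psi> 1 = \<zeta> 1" using M0 by (intro \<psi>eq) simp
    moreover have "\<zeta> 1 \<noteq> 1"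
    proof
      assume "\<zeta> 1 = 1"
      then have "cos (2 * pi / real p) = 1" by (simp add: \<zeta>_def complex_eq_iff)
      then obtain k :: int where k: "2 * pi / real p = real_of_int k * 2 * pi" by (auto simp: cos_one_2pi_int)
      then have "real_of_int k * real p = 1" using p0' by (simp add: field_simps)
      then have "real_of_int (k * int p) = real_of_int 1" by simp
      then have "k * int p = 1" by (simp only: of_int_eq_iff)
      then have "int p dvd 1" using dvd_triv_right[of "int p" k] by simp
      then show False using p by simp
    qed
    ultimately show ?thesis by simp
  qed
  ultimately show ?thesis unfolding additive_character_def by blast
qed

section \<open>Gauss sums of a fixed nontrivial character\<close>

context
  fixes \<psi> :: "'a::{field,finite} \<Rightarrow> complex"
  assumes odd_card: "odd CARD('a)" and \<psi>: "additive_character UNIV \<psi>"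
begin

lemma psi_add: "\<psi> (x + y) = \<psi> x * \<psi> y"
  and norm_psi [simp]: "norm (\<psi> x) = 1"
  using \<psi> by (auto simp: additive_character_def)

lemma psi_0 [simp]: "\<psi> 0 = 1"
  using psi_add[of 0 0] norm_psi[of 0] by (metis add_0 mult_cancel_right1 norm_zero zero_neq_one)

lemma psi_sum: "\<psi> (\<Sum>i\<in>I. f i) = (\<Prod>i\<in>I. \<psi> (f i))"
  by (induction I rule: infinite_finite_induct) (auto simp: psi_add)

lemma psi_neg: "\<psi> (- x) = cnj (\<psi> x)"
proof -
  have "\<psi> x * \<psi> (- x) = 1" using psi_add[of x "- x"] by simp
  moreover have "\<psi> x * cnj (\<psi> x) = 1" by (simp add: complex_norm_square[symmetric])
  moreover have "\<psi> x \<noteq> 0" using norm_psi[of x] by force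
  ultimately show ?thesis by (metis mult_left_cancel)
qed

lemma sum_psi_mult: "(\<Sum>x\<in>UNIV. \<psi> (x * b)) = (if b = 0 then of_nat CARD('a) else 0)"
proof (cases "b = 0")
  case False
  have "(\<Sum>x\<in>UNIV. \<psi> (x * b)) = (\<Sum>x\<in>UNIV. \<psi> x)"
    by (rule sum.reindex_bij_witness[of _ "\<lambda>x. x / b" "\<lambda>x. x * b"]) (use False in auto)
  also have "\<dots> = 0" by (rule sum_character_zero[OF _ _ _ \<psi>]) auto
  finally show ?thesis using False by simp
qed simp

lemma two_nonzero: "(2::'a) \<noteq> 0"
proof
  assume *: "(2::'a) = 0"
  obtain m where "CARD('a) = 2 * m + 1" using odd_card by (auto elim: oddE)
  then have "of_nat CARD('a) = 2 * of_nat m + (1::'a)" by simp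
  then show False by (simp add: * of_nat_card_eq_zero)
qed

lemma four_nonzero: "(4::'a) \<noteq> 0"
  using two_nonzero by (metis mult_2 mult_eq_0_iff numeral_Bit0)

definition gauss_sum :: "'a \<Rightarrow> complex" where
  "gauss_sum s = (\<Sum>x\<in>UNIV. \<psi> (s * x\<^sup>2))"

text \<open>Substituting x = u + y makes the phase linear in \<open>y\<close>, so summing over
  \<open>y\<close> leaves only u = 0, because 2 s is nonzero.\<close>

lemma gauss_sum_norm:
  assumes "s \<noteq> 0"
  shows "norm (gauss_sum s) = sqrt CARD('a)"
proof -
  have "gauss_sum s * cnj (gauss_sum s) = (\<Sum>x\<in>UNIV. \<Sum>y\<in>UNIV. \<psi> (s * x\<^sup>2 - s * y\<^sup>2))"
    by (simp add: gauss_sum_def sum_product psi_add psi_neg diff_conv_add_uminus del: add_uminus_conv_diff)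
  also have "\<dots> = (\<Sum>y\<in>UNIV. \<Sum>x\<in>UNIV. \<psi> (s * x\<^sup>2 - s * y\<^sup>2))" by (rule sum.swap)
  also have "\<dots> = (\<Sum>y\<in>UNIV. \<Sum>u\<in>UNIV. \<psi> (s * u\<^sup>2) * \<psi> (y * (2 * s * u)))"
  proof (rule sum.cong)
    fix y
    show "(\<Sum>x\<in>UNIV. \<psi> (s * x\<^sup>2 - s * y\<^sup>2)) = (\<Sum>u\<in>UNIV. \<psi> (s * u\<^sup>2) * \<psi> (y * (2 * s * u)))"
      by (rule sum.reindex_bij_witness[of _ "\<lambda>u. u + y" "\<lambda>x. x - y"])
         (auto simp: psi_add[symmetric] power2_eq_square algebra_simps)
  qed simp
  also have "\<dots> = (\<Sum>u\<in>UNIV. \<psi> (s * u\<^sup>2) * (\<Sum>y\<in>UNIV. \<psi> (y * (2 * s * u))))"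
    by (subst sum.swap) (simp add: sum_distrib_left)
  also have "\<dots> = (\<Sum>u\<in>(UNIV :: 'a set). if u = 0 then of_nat CARD('a) else 0)"
    by (rule sum.cong) (use assms two_nonzero in \<open>simp_all add: sum_psi_mult\<close>)
  finally have "gauss_sum s * cnj (gauss_sum s) = of_nat CARD('a)" by simp
  then have "of_real ((norm (gauss_sum s))\<^sup>2) = (of_real (real CARD('a)) :: complex)"
    by (simp only: complex_norm_square of_real_of_nat_eq)
  then have "(norm (gauss_sum s))\<^sup>2 = real CARD('a)" by (simp only: of_real_eq_iff)
  then show ?thesis by (metis norm_ge_zero real_sqrt_unique)
qed

lemma gauss_sum_square: "w \<noteq> 0 \<Longrightarrow> gauss_sum (s * w\<^sup>2) = gauss_sum s"
  unfolding gauss_sum_def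
  by (rule sum.reindex_bij_witness[of _ "\<lambda>x. x / w" "\<lambda>x. x * w"]) (auto simp: power_mult_distrib ac_simps)

lemma gauss_sum_fibres:
  "gauss_sum (s * l) = (\<Sum>y\<in>UNIV. of_nat (card {x. l * x\<^sup>2 = y}) * \<psi> (s * y))"
  using sum_by_fibres[of UNIV UNIV "\<lambda>x::'a. l * x\<^sup>2" "\<lambda>y. \<psi> (s * y)"]
  by (simp add: gauss_sum_def mult.assoc)

lemma card_square_roots_le: "card {x::'a. x\<^sup>2 = d} \<le> 2"
proof (cases "\<exists>w. w\<^sup>2 = d")
  case True
  then obtain w where "w\<^sup>2 = d" by blast
  then have "{x. x\<^sup>2 = d} = {w, - w}" by (auto simp: power2_eq_iff)
  moreover have "card {w, - w} \<le> 2" by (rule order_trans[OF card_insert_le_m1]) auto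
  ultimately show ?thesis by simp
qed simp

text \<open>The sign is the quadratic character of \<open>l\<close>. For a non-square
  \<open>l\<close> the forms x^2 and l x^2 together represent each element exactly twice, so the two
  Gauss sums add up to twice a full character sum, which vanishes.\<close>

lemma gauss_sum_twist:
  assumes l: "l \<noteq> 0"
  shows "\<exists>\<kappa>. (\<kappa> = 1 \<or> \<kappa> = - 1) \<and> (\<forall>s. s \<noteq> 0 \<longrightarrow> gauss_sum (s * l) = \<kappa> * gauss_sum s)"
proof (cases "\<exists>w. l = w\<^sup>2")
  case True
  then obtain w where "l = w\<^sup>2" by blast
  with l show ?thesis by (intro exI[of _ 1]) (auto simp: gauss_sum_square)
next
  case False
  define r where "r y = card {x. x\<^sup>2 = y} + card {x. l * x\<^sup>2 = y}" for y
  have le: "r y \<le> 2" for y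
  proof (cases "y = 0")
    case True
    then have "{x. x\<^sup>2 = y} = {0}" "{x. l * x\<^sup>2 = y} = {0}" using l by auto
    then show ?thesis by (simp add: r_def)
  next
    case y: False
    have dl: "{x. l * x\<^sup>2 = y} = {x. x\<^sup>2 = y / l}" using l by (auto simp: field_simps)
    have "{x. x\<^sup>2 = y} = {} \<or> {x. x\<^sup>2 = y / l} = {}"
    proof (rule ccontr)
      assume "\<not> ?thesis"
      then obtain u v where uv: "u\<^sup>2 = y" "v\<^sup>2 = y / l" by blast
      then have "v \<noteq> 0" using l y by auto
      with uv have "l = (u / v)\<^sup>2" using l y by (auto simp: power_divide field_simps)
      with False show False by blast
    qed
    then show ?thesis unfolding r_def dl using card_square_roots_le[of y] card_square_roots_le[of "y / l"] by auto
  qed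
  have fib: "(\<Sum>y\<in>UNIV. card {x. f x = y}) = CARD('a)" for f :: "'a \<Rightarrow> 'a"
    using sum_by_fibres[of UNIV UNIV f "\<lambda>_. 1::nat"] by simp
  \<comment> \<open>No value is represented more than twice and the total is twice the size of the
    field, so there is no deficit anywhere.\<close>
  have "(\<Sum>y\<in>UNIV. 2 - r y) = 0"
    using le by (subst sum_subtractf_nat) (simp_all add: r_def sum.distrib fib)
  then have r: "r y = 2" for y using le[of y] by (simp add: le_antisym)
  have "gauss_sum (s * l) = - 1 * gauss_sum s" if s: "s \<noteq> 0" for s
  proof -
    have "gauss_sum (s * 1) + gauss_sum (s * l) = (\<Sum>y\<in>UNIV. of_nat (r y) * \<psi> (s * y))"
      by (simp only: gauss_sum_fibres) (simp add: r_def sum.distrib algebra_simps)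
    also have "\<dots> = 2 * (\<Sum>y\<in>UNIV. \<psi> (y * s))"
      by (simp only: r sum_distrib_left) (simp add: mult.commute)
    also have "\<dots> = 0" using s by (simp add: sum_psi_mult)
    finally show ?thesis by (simp add: add_eq_0_iff)
  qed
  then show ?thesis by (intro exI[of _ "- 1"]) auto
qed

lemma gauss_sum_shifted:
  assumes "s \<noteq> 0"
  shows "(\<Sum>u\<in>UNIV. \<psi> (s * u\<^sup>2 + b * u)) = \<psi> (- (b\<^sup>2 / (4 * s))) * gauss_sum s"
proof -
  have "s * u\<^sup>2 + b * u = - (b\<^sup>2 / (4 * s)) + s * (u + b / (2 * s))\<^sup>2" for u
  proof -
    have e: "4 * s = 2 * (2 * s)" by simp
    define w where "w = b / (2 * s)"
    have b: "b = 2 * s * w" using assms two_nonzero by (simp add: w_def)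
    have "b\<^sup>2 / (4 * s) = s * w\<^sup>2"
      using assms four_nonzero unfolding b by (simp add: power2_eq_square)
    then show ?thesis unfolding w_def[symmetric] by (simp add: b power2_eq_square algebra_simps)
  qed
  then have "(\<Sum>u\<in>UNIV. \<psi> (s * u\<^sup>2 + b * u)) = (\<Sum>u\<in>UNIV. \<psi> (- (b\<^sup>2 / (4 * s))) * \<psi> (s * (u + b / (2 * s))\<^sup>2))"
    by (simp only: psi_add)
  also have "\<dots> = \<psi> (- (b\<^sup>2 / (4 * s))) * (\<Sum>u\<in>UNIV. \<psi> (s * (u + b / (2 * s))\<^sup>2))"
    by (simp add: sum_distrib_left)
  also have "(\<Sum>u\<in>UNIV. \<psi> (s * (u + b / (2 * s))\<^sup>2)) = gauss_sum s"
    unfolding gauss_sum_def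
    by (rule sum.reindex_bij_witness[of _ "\<lambda>u. u - b / (2 * s)" "\<lambda>u. u + b / (2 * s)"]) auto
  finally show ?thesis .
qed

lemma fourier_inj:
  fixes f g :: "'a \<Rightarrow> complex"
  assumes "\<And>c. (\<Sum>n\<in>UNIV. f n * \<psi> (n * c)) = (\<Sum>n\<in>UNIV. g n * \<psi> (n * c))"
  shows "f m = g m"
proof -
  have inv: "(\<Sum>c\<in>UNIV. (\<Sum>n\<in>UNIV. f n * \<psi> (n * c)) * \<psi> (- (m * c))) = of_nat CARD('a) * f m"
    for f :: "'a \<Rightarrow> complex"
  proof -
    have "(\<Sum>c\<in>UNIV. (\<Sum>n\<in>UNIV. f n * \<psi> (n * c)) * \<psi> (- (m * c))) =
        (\<Sum>c\<in>UNIV. \<Sum>n\<in>UNIV. f n * \<psi> (c * (n - m)))"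
      by (simp add: sum_distrib_right mult.assoc psi_add[symmetric]) (simp add: algebra_simps)
    also have "\<dots> = (\<Sum>n\<in>UNIV. f n * (\<Sum>c\<in>UNIV. \<psi> (c * (n - m))))"
      by (subst sum.swap) (simp add: sum_distrib_left)
    also have "\<dots> = (\<Sum>n\<in>UNIV. if n = m then of_nat CARD('a) * f m else 0)"
      by (intro sum.cong refl) (simp add: sum_psi_mult)
    finally show ?thesis by simp
  qed
  have "of_nat CARD('a) * f m = of_nat CARD('a) * g m"
    using inv[of f] inv[of g] assms by simp
  then show ?thesis by simp
qed

text \<open>The Salie sum is evaluated by comparing Fourier transforms in \<open>n\<close>.\<close>

lemma salie_sum_bound:
  assumes l: "l \<noteq> 0"
  shows "norm (\<Sum>s\<in>UNIV - {0}. \<psi> (- (s * l) - n / s) * gauss_sum s) \<le> 2 * real CARD('a)"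
proof -
  define T where "T n = (\<Sum>s\<in>UNIV - {0}. \<psi> (- (s * l) - n / s) * gauss_sum s)" for n
  \<comment> \<open>The closed form has at most two terms, one for each square root of 4 l
    n.\<close>
  define U where "U n = (\<Sum>v\<in>{v. v\<^sup>2 = 4 * l * n}. \<psi> v)" for n
  obtain \<kappa> where k: "(\<kappa> = 1 \<or> \<kappa> = - 1) \<and> (\<forall>s. s \<noteq> 0 \<longrightarrow> gauss_sum (s * l) = \<kappa> * gauss_sum s)"
    using gauss_sum_twist[OF l] ..
  then have \<kappa>: "\<kappa> = 1 \<or> \<kappa> = - 1" "\<And>s. s \<noteq> 0 \<Longrightarrow> gauss_sum (s * l) = \<kappa> * gauss_sum s" by auto
  have "T n = of_nat CARD('a) * \<kappa> * U n"
  proof (rule fourier_inj)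
    fix c
    have "(\<Sum>n\<in>UNIV. T n * \<psi> (n * c)) =
        (\<Sum>n\<in>UNIV. \<Sum>s\<in>UNIV - {0}. \<psi> (- (s * l)) * gauss_sum s * \<psi> (n * (c - 1 / s)))"
    proof (intro sum.cong refl)
      fix n
      have *: "\<psi> (- (s * l) - n / s) * gauss_sum s * \<psi> (n * c) = \<psi> (- (s * l)) * gauss_sum s * \<psi> (n * (c - 1 / s))" for s
      proof -
        have "\<psi> (- (s * l) - n / s) * \<psi> (n * c) = \<psi> (- (s * l)) * \<psi> (n * (c - 1 / s))"
          unfolding psi_add[symmetric] by (simp add: algebra_simps)
        then show ?thesis by (metis mult.assoc mult.commute)
      qed
      show "T n * \<psi> (n * c) = (\<Sum>s\<in>UNIV - {0}. \<psi> (- (s * l)) * gauss_sum s * \<psi> (n * (c - 1 / s)))"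
        unfolding T_def sum_distrib_right by (intro sum.cong refl *)
    qed
    also have "\<dots> = (\<Sum>s\<in>UNIV - {0}. \<psi> (- (s * l)) * gauss_sum s * (\<Sum>n\<in>UNIV. \<psi> (n * (c - 1 / s))))"
      by (subst sum.swap) (simp add: sum_distrib_left)
    also have "\<dots> = (\<Sum>s\<in>UNIV - {0}. if s = 1 / c then \<psi> (- (s * l)) * gauss_sum s * of_nat CARD('a) else 0)"
    proof (intro sum.cong refl)
      fix s :: 'a assume "s \<in> UNIV - {0}"
      \<comment> \<open>For c = 0 both sides are false: 1 / c is 0 by convention, and
        \<open>s\<close> is nonzero.\<close>
      then have "c - 1 / s = 0 \<longleftrightarrow> s = 1 / c" by (cases "c = 0") (auto simp: field_simps)
      then show "\<psi> (- (s * l)) * gauss_sum s * (\<Sum>n\<in>UNIV. \<psi> (n * (c - 1 / s)))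
          = (if s = 1 / c then \<psi> (- (s * l)) * gauss_sum s * of_nat CARD('a) else 0)"
        by (simp only: sum_psi_mult) simp
    qed
    also have "\<dots> = (if c = 0 then 0 else \<psi> (- (l / c)) * gauss_sum (1 / c) * of_nat CARD('a))"
      by (auto simp: sum.delta)
    finally have T: "(\<Sum>n\<in>UNIV. T n * \<psi> (n * c)) = \<dots>" .
    have nv: "v\<^sup>2 = 4 * l * n \<longleftrightarrow> n = v\<^sup>2 / (4 * l)" for v n
      using l four_nonzero by (auto simp: field_simps)
    have "(\<Sum>n\<in>UNIV. U n * \<psi> (n * c)) = (\<Sum>n\<in>UNIV. \<Sum>v\<in>UNIV. if n = v\<^sup>2 / (4 * l) then \<psi> v * \<psi> (n * c) else 0)"
      unfolding U_def sum_distrib_right nv by (intro sum.cong refl sum.mono_neutral_cong_left) auto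
    also have "\<dots> = (\<Sum>v\<in>UNIV. \<psi> v * \<psi> (v\<^sup>2 / (4 * l) * c))"
      by (subst sum.swap) simp
    also have "\<dots> = (\<Sum>v\<in>UNIV. \<psi> (c / (4 * l) * v\<^sup>2 + 1 * v))"
      by (simp add: psi_add[symmetric] algebra_simps)
    also have "\<dots> = (if c = 0 then 0 else \<psi> (- (l / c)) * (\<kappa> * gauss_sum (1 / c)))"
    proof (cases "c = 0")
      case True
      then show ?thesis using sum_psi_mult[of 1] by simp
    next
      case False
      have c: "c / (4 * l) \<noteq> 0" using False l four_nonzero by simp
      \<comment> \<open>c/(4 l) is (1/c) l times a square. This brings the Gauss sum to the argument
        1/c found for \<open>T\<close>, at the price of the sign \<kappa>.\<close>
      have "gauss_sum (c / (4 * l)) = gauss_sum ((1 / c) * l * (c / (2 * l))\<^sup>2)"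
        using False l two_nonzero four_nonzero by (simp add: power2_eq_square field_simps)
      also have "\<dots> = gauss_sum ((1 / c) * l)" using False l two_nonzero by (intro gauss_sum_square) simp
      also have "\<dots> = \<kappa> * gauss_sum (1 / c)" using False by (intro \<kappa>(2)) simp
      finally have "gauss_sum (c / (4 * l)) = \<kappa> * gauss_sum (1 / c)" .
      moreover have "1\<^sup>2 / (4 * (c / (4 * l))) = l / c" using four_nonzero by simp
      ultimately show ?thesis using gauss_sum_shifted[OF c, of 1] False by simp
    qed
    finally have U: "(\<Sum>n\<in>UNIV. U n * \<psi> (n * c)) = \<dots>" .
    have "\<kappa> * \<kappa> = 1" using \<kappa>(1) by auto
    then show "(\<Sum>n\<in>UNIV. T n * \<psi> (n * c)) = (\<Sum>n\<in>UNIV. of_nat CARD('a) * \<kappa> * U n * \<psi> (n * c))"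
      using T U by (simp add: mult.assoc sum_distrib_left[symmetric])
  qed
  moreover have "norm (U n) \<le> 2"
  proof -
    have "norm (U n) \<le> (\<Sum>v\<in>{v. v\<^sup>2 = 4 * l * n}. 1)" unfolding U_def by (rule sum_norm_le) simp
    also have "\<dots> \<le> 2" using card_square_roots_le[of "4 * l * n"] by simp
    finally show ?thesis .
  qed
  moreover have "norm \<kappa> = 1" using \<kappa>(1) by auto
  ultimately show ?thesis unfolding T_def[symmetric] by (simp add: norm_mult)
qed

text \<open>A twist changes a Gauss sum only by a sign, so even powers do not depend on
  \<open>s\<close> and come out of the sum. What remains carries the Gauss sum to the power 0 or 1;
  for even \<open>d\<close> and n = 0 it is just -1.\<close>

lemma sum_twisted_bound:
  assumes l: "l \<noteq> 0"
  shows "norm (\<Sum>s\<in>UNIV - {0}. \<psi> (- (s * l) - n / s) * gauss_sum s ^ d) \<le> 2 * sqrt CARD('a) ^ (d + 1)"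
proof -
  define q where "q = real CARD('a)"
  have q1: "q \<ge> 1" using card_field_ge_2[where 'a='a] by (simp add: q_def)
  have sq: "gauss_sum s ^ 2 = gauss_sum 1 ^ 2" if "s \<noteq> 0" for s
    using gauss_sum_twist[OF that] by (metis mult_1 one_neq_zero power_mult_distrib power2_minus power_one)
  have sqe: "gauss_sum s ^ (2 * e) = gauss_sum 1 ^ (2 * e)" if "s \<noteq> 0" for s e
    by (simp only: power_mult sq[OF that])
  have n1: "norm (gauss_sum 1) = sqrt q" using gauss_sum_norm[of 1] by (simp add: q_def)
  show ?thesis
  proof (cases "even d")
    case True
    then obtain e where e: "d = 2 * e" by blast
    have "(\<Sum>s\<in>UNIV - {0}. \<psi> (- (s * l) - n / s) * gauss_sum s ^ d)
        = (\<Sum>s\<in>UNIV - {0}. \<psi> (- (s * l) - n / s)) * gauss_sum 1 ^ d"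
      unfolding sum_distrib_right e by (intro sum.cong refl) (metis DiffE insertI1 sqe)
    moreover have "norm (\<Sum>s\<in>UNIV - {0}. \<psi> (- (s * l) - n / s)) \<le> 2 * sqrt q"
    proof (cases "n = 0")
      case True
      have "(\<Sum>s\<in>UNIV. \<psi> (s * (- l))) = 0" using l by (subst sum_psi_mult) simp
      then have "(\<Sum>s\<in>UNIV - {0}. \<psi> (- (s * l) - n / s)) = - 1"
        using True by (simp add: sum_diff1)
      then have "norm (\<Sum>s\<in>UNIV - {0}. \<psi> (- (s * l) - n / s)) = 1" by simp
      moreover have "1 \<le> sqrt q" using q1 by simp
      ultimately show ?thesis by linarith
    next
      case False
      have "(\<Sum>s\<in>UNIV - {0}. \<psi> (- (s * l) - n / s)) = kloosterman UNIV \<psi> (l * n)"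
        unfolding kloosterman_def
        by (rule sum.reindex_bij_witness[of _ "\<lambda>x. - (x / l)" "\<lambda>s. - (s * l)"]) (use l in \<open>auto simp: field_simps\<close>)
      then show ?thesis using kloosterman_bound[OF odd_card \<psi>, of "l * n"] l False by (simp add: q_def)
    qed
    ultimately have "norm (\<Sum>s\<in>UNIV - {0}. \<psi> (- (s * l) - n / s) * gauss_sum s ^ d) \<le> 2 * sqrt q * sqrt q ^ d"
      using q1 by (auto simp: norm_mult norm_power n1 intro!: mult_right_mono)
    then show ?thesis by (simp add: q_def mult.assoc)
  next
    case False
    then obtain e where e: "d = 2 * e + 1" by (auto elim: oddE)
    have "(\<Sum>s\<in>UNIV - {0}. \<psi> (- (s * l) - n / s) * gauss_sum s ^ d)
        = (\<Sum>s\<in>UNIV - {0}. \<psi> (- (s * l) - n / s) * gauss_sum s) * gauss_sum 1 ^ (2 * e)"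
      unfolding sum_distrib_right e
    proof (rule sum.cong)
      fix s :: 'a assume "s \<in> UNIV - {0}"
      then have "gauss_sum s ^ (2 * e + 1) = gauss_sum s * gauss_sum 1 ^ (2 * e)"
        using sqe[of s e] by (simp only: power_add power_one_right) (simp add: mult.commute)
      then show "\<psi> (- (s * l) - n / s) * gauss_sum s ^ (2 * e + 1) = \<psi> (- (s * l) - n / s) * gauss_sum s * gauss_sum 1 ^ (2 * e)"
        by (simp only: mult.assoc)
    qed simp
    then have "norm (\<Sum>s\<in>UNIV - {0}. \<psi> (- (s * l) - n / s) * gauss_sum s ^ d) \<le> 2 * q * sqrt q ^ (2 * e)"
      using salie_sum_bound[OF l, of n]
      using q1 by (auto simp: norm_mult norm_power n1 q_def intro!: mult_right_mono)
    also have "\<dots> = 2 * sqrt q ^ (d + 1)"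
    proof -
      have "q = sqrt q * sqrt q" using q1 by simp
      then show ?thesis by (simp add: e)
    qed
    finally show ?thesis by (simp add: q_def)
  qed
qed

end

section \<open>The kernel of a sphere\<close>

definition vec_dot :: "'a::comm_ring_1 ^ 'd \<Rightarrow> 'a ^ 'd \<Rightarrow> 'a" where
  "vec_dot x y = (\<Sum>j\<in>UNIV. x $ j * y $ j)"

lemma vec_dot_diff: "vec_dot x (y - z) = vec_dot x y - vec_dot x z"
  by (simp add: vec_dot_def algebra_simps sum_subtractf)

lemma sum_vec_prod:
  fixes f :: "'d::finite \<Rightarrow> 'a::finite \<Rightarrow> 'c::comm_semiring_1"
  shows "(\<Sum>v\<in>(UNIV :: ('a ^ 'd) set). \<Prod>j\<in>UNIV. f j (v $ j)) = (\<Prod>j\<in>UNIV. \<Sum>u\<in>UNIV. f j u)"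
proof -
  have "(\<Prod>j\<in>UNIV. \<Sum>u\<in>UNIV. f j u) = (\<Sum>g\<in>(UNIV :: 'd set) \<rightarrow>\<^sub>E UNIV. \<Prod>j\<in>UNIV. f j (g j))"
    by (rule prod_sum_PiE) auto
  also have "\<dots> = (\<Sum>v\<in>(UNIV :: ('a ^ 'd) set). \<Prod>j\<in>UNIV. f j (v $ j))"
    by (rule sum.reindex_bij_witness[of _ vec_nth vec_lambda]) (auto simp: PiE_def)
  finally show ?thesis by simp
qed

lemma sum_norm_mult_le:
  fixes f g :: "'i \<Rightarrow> complex"
  shows "(\<Sum>i\<in>I. norm (f i) * norm (g i)) \<le> sqrt (\<Sum>i\<in>I. (norm (f i))\<^sup>2) * sqrt (\<Sum>i\<in>I. (norm (g i))\<^sup>2)"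
  using L2_set_mult_ineq[of "\<lambda>i. norm (f i)" "\<lambda>i. norm (g i)" I] by (simp add: L2_set_def)

context
  fixes \<psi> :: "'a::{field,finite} \<Rightarrow> complex"
  assumes odd_card: "odd CARD('a)" and \<psi>: "additive_character UNIV \<psi>"
begin

lemmas psi_rules = psi_add[OF odd_card \<psi>] psi_neg[OF odd_card \<psi>] psi_sum[OF odd_card \<psi>]
  norm_psi[OF odd_card \<psi>] psi_0[OF odd_card \<psi>]

lemma psi_vec_dot_diff: "\<psi> (vec_dot \<xi> (x - y)) = \<psi> (vec_dot \<xi> x) * cnj (\<psi> (vec_dot \<xi> y))"
  using psi_rules(1)[of "vec_dot \<xi> x" "- vec_dot \<xi> y"] by (simp add: vec_dot_diff psi_rules(2))

lemma sum_psi_vec_dot: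
  fixes z :: "'a ^ 'd"
  shows "(\<Sum>\<xi>\<in>UNIV. \<psi> (vec_dot \<xi> z)) = (if z = 0 then of_nat CARD('a) ^ CARD('d) else 0)"
proof -
  have "(\<Sum>\<xi>\<in>UNIV. \<psi> (vec_dot \<xi> z)) = (\<Sum>\<xi>\<in>(UNIV :: ('a ^ 'd) set). \<Prod>j\<in>UNIV. \<psi> (\<xi> $ j * z $ j))"
    by (simp add: vec_dot_def psi_rules)
  also have "\<dots> = (\<Prod>j\<in>UNIV. \<Sum>u\<in>UNIV. \<psi> (u * z $ j))" by (rule sum_vec_prod)
  also have "\<dots> = (\<Prod>j\<in>UNIV. if z $ j = 0 then of_nat CARD('a) else 0)"
    by (simp add: sum_psi_mult[OF odd_card \<psi>])
  also have "\<dots> = (if z = 0 then of_nat CARD('a) ^ CARD('d) else 0)"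
  proof (cases "z = 0")
    case False
    then obtain j where "z $ j \<noteq> 0" by (auto simp: vec_eq_iff)
    with False show ?thesis by (auto intro!: prod_zero)
  qed simp
  finally show ?thesis .
qed

text \<open>The deviation of the sphere from its expected density 1/q, scaled by q. Subtracting 1
  removes exactly the trivial frequency s = 0 from the expansion of the indicator.\<close>

definition sphere_kernel :: "'a \<Rightarrow> 'a ^ 'd \<Rightarrow> complex" where
  "sphere_kernel l z = of_nat CARD('a) * of_bool (sqnorm z = l) - 1"

definition sphere_kernel_hat :: "'a \<Rightarrow> 'a ^ 'd \<Rightarrow> complex" where
  "sphere_kernel_hat l \<xi> = (\<Sum>z\<in>UNIV. sphere_kernel l z * \<psi> (- vec_dot \<xi> z))"

lemma sphere_kernel_eq:
  "sphere_kernel l (z :: 'a ^ 'd) = (\<Sum>s\<in>UNIV - {0}. \<psi> (s * (sqnorm z - l)))"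
proof -
  have "(\<Sum>s\<in>UNIV. \<psi> (s * (sqnorm z - l))) = of_nat CARD('a) * of_bool (sqnorm z = l)"
    by (simp add: sum_psi_mult[OF odd_card \<psi>])
  then show ?thesis by (simp add: sum_diff1 psi_rules sphere_kernel_def)
qed

text \<open>The exponential factorises over the coordinates into shifted Gauss sums with a common
  \<open>s\<close>. Completing the squares leaves the phase -n/s, with \<open>n\<close> a quarter of
  the squared norm of \<xi>. The frequency \<xi> = 0 is covered as well, so there is no main term to
  split off.\<close>

lemma sphere_kernel_hat_bound:
  fixes \<xi> :: "'a ^ 'd"
  assumes l: "l \<noteq> 0"
  shows "norm (sphere_kernel_hat l \<xi>) \<le> 2 * sqrt CARD('a) ^ (CARD('d) + 1)"
proof -
  define n where "n = (\<Sum>j\<in>UNIV. (\<xi> $ j)\<^sup>2) / 4"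
  have inner: "(\<Sum>z\<in>UNIV. \<psi> (s * (sqnorm z - l)) * \<psi> (- vec_dot \<xi> z))
      = \<psi> (- (s * l) - n / s) * gauss_sum \<psi> s ^ CARD('d)" if s: "s \<noteq> 0" for s
  proof -
    have "s * (sqnorm z - l) + - vec_dot \<xi> z = - (s * l) + (\<Sum>j\<in>UNIV. s * (z $ j)\<^sup>2 + (- \<xi> $ j) * z $ j)" for z
      by (simp add: sqnorm_def vec_dot_def sum.distrib sum_subtractf sum_distrib_left sum_negf algebra_simps)
    then have "(\<Sum>z\<in>UNIV. \<psi> (s * (sqnorm z - l)) * \<psi> (- vec_dot \<xi> z))
        = (\<Sum>z\<in>(UNIV :: ('a ^ 'd) set). \<psi> (- (s * l)) * (\<Prod>j\<in>UNIV. \<psi> (s * (z $ j)\<^sup>2 + (- \<xi> $ j) * z $ j)))"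
      by (simp only: psi_rules(1)[symmetric] psi_rules(3)[symmetric])
    also have "\<dots> = \<psi> (- (s * l)) * (\<Prod>j\<in>UNIV. \<Sum>u\<in>UNIV. \<psi> (s * u\<^sup>2 + (- \<xi> $ j) * u))"
      by (simp only: sum_distrib_left[symmetric] sum_vec_prod[of "\<lambda>j u. \<psi> (s * u\<^sup>2 + (- \<xi> $ j) * u)"])
    also have "\<dots> = \<psi> (- (s * l)) * (\<Prod>j\<in>UNIV. \<psi> (- ((- \<xi> $ j)\<^sup>2 / (4 * s))) * gauss_sum \<psi> s)"
      by (simp only: gauss_sum_shifted[OF odd_card \<psi> s])
    also have "\<dots> = \<psi> (- (s * l) + (\<Sum>j\<in>UNIV. - ((- \<xi> $ j)\<^sup>2 / (4 * s)))) * gauss_sum \<psi> s ^ CARD('d)"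
      by (simp only: prod.distrib prod_constant psi_rules(1,3) mult.assoc)
    also have "(\<Sum>j\<in>UNIV. - ((- \<xi> $ j)\<^sup>2 / (4 * s))) = - (n / s)"
      by (simp add: n_def sum_negf sum_divide_distrib)
    finally show ?thesis by simp
  qed
  have "sphere_kernel_hat l \<xi> = (\<Sum>z\<in>UNIV. \<Sum>s\<in>UNIV - {0}. \<psi> (s * (sqnorm z - l)) * \<psi> (- vec_dot \<xi> z))"
    by (simp add: sphere_kernel_hat_def sphere_kernel_eq sum_distrib_right)
  also have "\<dots> = (\<Sum>s\<in>UNIV - {0}. \<psi> (- (s * l) - n / s) * gauss_sum \<psi> s ^ CARD('d))"
    by (subst sum.swap) (intro sum.cong refl inner, simp)
  finally show ?thesis using sum_twisted_bound[OF odd_card \<psi> l, where n = n and d = "CARD('d)"] by simp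
qed

lemma sphere_kernel_inversion:
  fixes z :: "'a ^ 'd"
  shows "(\<Sum>\<xi>\<in>UNIV. sphere_kernel_hat l \<xi> * \<psi> (vec_dot \<xi> z)) = of_nat CARD('a) ^ CARD('d) * sphere_kernel l z"
proof -
  have "(\<Sum>\<xi>\<in>UNIV. sphere_kernel_hat l \<xi> * \<psi> (vec_dot \<xi> z))
      = (\<Sum>\<xi>\<in>UNIV. \<Sum>w\<in>UNIV. sphere_kernel l w * \<psi> (vec_dot \<xi> (z - w)))"
    by (simp add: sphere_kernel_hat_def sum_distrib_right mult.assoc psi_rules(1)[symmetric] vec_dot_diff add.commute)
  also have "\<dots> = (\<Sum>w\<in>UNIV. sphere_kernel l w * (\<Sum>\<xi>\<in>UNIV. \<psi> (vec_dot \<xi> (z - w))))"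
    by (subst sum.swap) (simp add: sum_distrib_left)
  also have "\<dots> = (\<Sum>w\<in>UNIV. if z = w then sphere_kernel l w * of_nat CARD('a) ^ CARD('d) else 0)"
    unfolding sum_psi_vec_dot by (intro sum.cong refl) simp
  finally show ?thesis by (simp add: mult.commute)
qed

lemma parseval:
  fixes a :: "'a ^ 'd \<Rightarrow> real"
  shows "(\<Sum>\<xi>\<in>UNIV. (norm (\<Sum>x\<in>UNIV. of_real (a x) * \<psi> (vec_dot \<xi> x)))\<^sup>2)
    = real CARD('a) ^ CARD('d) * (\<Sum>x\<in>UNIV. (a x)\<^sup>2)"
proof -
  have "of_real (\<Sum>\<xi>\<in>UNIV. (norm (\<Sum>x\<in>UNIV. of_real (a x) * \<psi> (vec_dot \<xi> x)))\<^sup>2)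
      = (\<Sum>\<xi>\<in>UNIV. \<Sum>x\<in>UNIV. \<Sum>y\<in>UNIV. of_real (a x * a y) * \<psi> (vec_dot \<xi> (x - y)))"
    unfolding of_real_sum complex_norm_square
    by (simp add: sum_product psi_vec_dot_diff ac_simps)
  also have "\<dots> = (\<Sum>x\<in>UNIV. \<Sum>\<xi>\<in>UNIV. \<Sum>y\<in>UNIV. of_real (a x * a y) * \<psi> (vec_dot \<xi> (x - y)))"
    by (rule sum.swap)
  also have "\<dots> = (\<Sum>x\<in>UNIV. \<Sum>y\<in>UNIV. \<Sum>\<xi>\<in>UNIV. of_real (a x * a y) * \<psi> (vec_dot \<xi> (x - y)))"
    by (intro sum.cong refl sum.swap)
  also have "\<dots> = (\<Sum>x\<in>UNIV. \<Sum>y\<in>UNIV. of_real (a x * a y) * (\<Sum>\<xi>\<in>UNIV. \<psi> (vec_dot \<xi> (x - y))))"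
    by (simp add: sum_distrib_left)
  also have "\<dots> = (\<Sum>x\<in>UNIV. \<Sum>y\<in>UNIV. if x = y then of_real ((a x)\<^sup>2 * real CARD('a) ^ CARD('d)) else 0)"
    unfolding sum_psi_vec_dot by (intro sum.cong refl) (simp add: power2_eq_square)
  also have "\<dots> = of_real (real CARD('a) ^ CARD('d) * (\<Sum>x\<in>UNIV. (a x)\<^sup>2))"
    by (simp add: sum_distrib_left mult.commute)
  finally show ?thesis by (simp only: of_real_eq_iff)
qed

text \<open>The kernel depends on x - y only, so characters diagonalise it and its largest Fourier
  coefficient bounds the norm. The factor \<open>Q\<close> from inversion cancels against the two
  factors sqrt \<open>Q\<close> from Parseval.\<close>

lemma sphere_bilinear_bound_of_character:
  fixes a b :: "'a ^ 'd \<Rightarrow> real"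
  assumes l: "l \<noteq> 0"
  shows "\<bar>\<Sum>x\<in>UNIV. \<Sum>y\<in>UNIV. a x * b y * (real CARD('a) * of_bool (sqnorm (x - y) = l) - 1)\<bar>
    \<le> 2 * sqrt CARD('a) ^ (CARD('d) + 1) * (sqrt (\<Sum>x\<in>UNIV. (a x)\<^sup>2) * sqrt (\<Sum>y\<in>UNIV. (b y)\<^sup>2))"
proof -
  define Q where "Q = real CARD('a) ^ CARD('d)"
  have Q: "Q > 0" by (simp add: Q_def)
  define M where "M = 2 * sqrt CARD('a) ^ (CARD('d) + 1)"
  define ft where "ft a \<xi> = (\<Sum>x\<in>UNIV. of_real (a x) * \<psi> (vec_dot \<xi> x))" for a :: "'a ^ 'd \<Rightarrow> real" and \<xi>
  define B where "B = (\<Sum>x\<in>UNIV. \<Sum>y\<in>UNIV. a x * b y * (real CARD('a) * of_bool (sqnorm (x - y) = l) - 1))"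
  have "of_real (Q * B) = (\<Sum>x\<in>UNIV. \<Sum>y\<in>UNIV. of_real (a x * b y) * (of_nat CARD('a) ^ CARD('d) * sphere_kernel l (x - y)))"
    by (simp add: B_def Q_def sphere_kernel_def sum_distrib_left of_bool_def if_distrib[of of_real] ac_simps cong: if_cong)
  also have "\<dots> = (\<Sum>x\<in>UNIV. \<Sum>y\<in>UNIV. \<Sum>\<xi>\<in>UNIV. sphere_kernel_hat l \<xi> *
      ((of_real (a x) * \<psi> (vec_dot \<xi> x)) * cnj (of_real (b y) * \<psi> (vec_dot \<xi> y))))"
    unfolding sphere_kernel_inversion[symmetric]
    by (simp add: sum_distrib_left psi_vec_dot_diff ac_simps)
  also have "\<dots> = (\<Sum>x\<in>UNIV. \<Sum>\<xi>\<in>UNIV. \<Sum>y\<in>UNIV. sphere_kernel_hat l \<xi> *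
      ((of_real (a x) * \<psi> (vec_dot \<xi> x)) * cnj (of_real (b y) * \<psi> (vec_dot \<xi> y))))"
    by (intro sum.cong refl sum.swap)
  also have "\<dots> = (\<Sum>\<xi>\<in>UNIV. \<Sum>x\<in>UNIV. \<Sum>y\<in>UNIV. sphere_kernel_hat l \<xi> *
      ((of_real (a x) * \<psi> (vec_dot \<xi> x)) * cnj (of_real (b y) * \<psi> (vec_dot \<xi> y))))"
    by (rule sum.swap)
  also have "\<dots> = (\<Sum>\<xi>\<in>UNIV. sphere_kernel_hat l \<xi> * (ft a \<xi> * cnj (ft b \<xi>)))"
    by (simp only: ft_def cnj_sum sum_distrib_left[symmetric] sum_distrib_right[symmetric])
  finally have "\<bar>Q * B\<bar> = norm (\<Sum>\<xi>\<in>UNIV. sphere_kernel_hat l \<xi> * (ft a \<xi> * cnj (ft b \<xi>)))"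
    by (metis norm_of_real)
  also have "\<dots> \<le> (\<Sum>\<xi>\<in>UNIV. M * (norm (ft a \<xi>) * norm (ft b \<xi>)))"
    using sphere_kernel_hat_bound[where 'd = 'd, OF l]
    by (intro sum_norm_le) (simp add: norm_mult M_def mult_right_mono)
  also have "\<dots> = M * (\<Sum>\<xi>\<in>UNIV. norm (ft a \<xi>) * norm (ft b \<xi>))" by (simp add: sum_distrib_left)
  also have "\<dots> \<le> M * (sqrt (\<Sum>\<xi>\<in>UNIV. (norm (ft a \<xi>))\<^sup>2) * sqrt (\<Sum>\<xi>\<in>UNIV. (norm (ft b \<xi>))\<^sup>2))"
    by (intro mult_left_mono sum_norm_mult_le) (simp add: M_def)
  also have "\<dots> = M * (sqrt (Q * (\<Sum>x\<in>UNIV. (a x)\<^sup>2)) * sqrt (Q * (\<Sum>y\<in>UNIV. (b y)\<^sup>2)))"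
    unfolding ft_def parseval Q_def ..
  also have "\<dots> = Q * (M * (sqrt (\<Sum>x\<in>UNIV. (a x)\<^sup>2) * sqrt (\<Sum>y\<in>UNIV. (b y)\<^sup>2)))"
    using Q by (simp add: real_sqrt_mult)
  finally have "\<bar>B\<bar> \<le> M * (sqrt (\<Sum>x\<in>UNIV. (a x)\<^sup>2) * sqrt (\<Sum>y\<in>UNIV. (b y)\<^sup>2))"
    using Q by (simp add: abs_mult)
  then show ?thesis unfolding B_def M_def .
qed

end

lemma sphere_bilinear_bound:
  fixes A :: "('a::{field,finite} ^ 'd) set"
  assumes "odd CARD('a)" "l \<noteq> 0"
  shows "\<bar>\<Sum>x\<in>A. \<Sum>y\<in>A. a x * b y * (real CARD('a) * of_bool (sqnorm (x - y) = l) - 1)\<bar>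
    \<le> 2 * sqrt CARD('a) ^ (CARD('d) + 1) * (sqrt (\<Sum>x\<in>A. (a x)\<^sup>2) * sqrt (\<Sum>y\<in>A. (b y)\<^sup>2))"
proof -
  obtain \<psi> :: "'a \<Rightarrow> complex" where \<psi>: "additive_character UNIV \<psi>" using exists_additive_character by blast
  \<comment> \<open>Extension by zero moves the sums from \<open>A\<close> to the whole space, where
    Fourier analysis applies.\<close>
  define a' b' where "a' x = of_bool (x \<in> A) * a x" and "b' x = of_bool (x \<in> A) * b x" for x
  have "(\<Sum>x\<in>UNIV. \<Sum>y\<in>UNIV. a' x * b' y * (real CARD('a) * of_bool (sqnorm (x - y) = l) - 1))
      = (\<Sum>x\<in>A. \<Sum>y\<in>A. a x * b y * (real CARD('a) * of_bool (sqnorm (x - y) = l) - 1))"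
    by (rule sum.mono_neutral_cong_right, simp, simp, simp add: a'_def,
        rule sum.mono_neutral_cong_right) (auto simp: a'_def b'_def)
  moreover have "(\<Sum>x\<in>UNIV. (a' x)\<^sup>2) = (\<Sum>x\<in>A. (a x)\<^sup>2)"
    by (rule sum.mono_neutral_cong_right) (auto simp: a'_def)
  moreover have "(\<Sum>x\<in>UNIV. (b' x)\<^sup>2) = (\<Sum>x\<in>A. (b x)\<^sup>2)"
    by (rule sum.mono_neutral_cong_right) (auto simp: b'_def)
  ultimately show ?thesis
    using sphere_bilinear_bound_of_character[OF assms(1) \<psi> assms(2), of a' b'] by simp
qed

section \<open>Counting distance graphs\<close>

text \<open>Resampling one coordinate replaces splitting the product space into factors.\<close>

lemma sum_PiE_update:
  fixes \<Phi> :: "('i \<Rightarrow> 'p) \<Rightarrow> real"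
  assumes "finite A" "u \<in> V" "finite V"
  shows "(\<Sum>f\<in>V \<rightarrow>\<^sub>E A. \<Sum>x\<in>A. \<Phi> (f(u := x))) = real (card A) * (\<Sum>f\<in>V \<rightarrow>\<^sub>E A. \<Phi> f)"
proof -
  have "(\<Sum>f\<in>V \<rightarrow>\<^sub>E A. \<Sum>x\<in>A. \<Phi> (f(u := x))) = (\<Sum>z\<in>(V \<rightarrow>\<^sub>E A) \<times> A. \<Phi> ((fst z)(u := snd z)))"
    by (simp add: sum.cartesian_product split_def)
  also have "\<dots> = (\<Sum>z\<in>(V \<rightarrow>\<^sub>E A) \<times> A. \<Phi> (fst z))"
    by (rule sum.reindex_bij_witness[of _ "\<lambda>z. ((fst z)(u := snd z), fst z u)" "\<lambda>z. ((fst z)(u := snd z), fst z u)"])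
       (use assms(2) in \<open>auto simp: PiE_def extensional_def\<close>)
  also have "\<dots> = (\<Sum>f\<in>V \<rightarrow>\<^sub>E A. \<Sum>x\<in>A. \<Phi> f)"
    unfolding sum.cartesian_product split_def ..
  finally show ?thesis by (simp add: sum_distrib_left)
qed

text \<open>The relation \<open>R\<close> stays abstract: the counting knows the geometry only
  through a bilinear estimate for each edge.\<close>

definition edge_homs :: "'i set \<Rightarrow> 'p set \<Rightarrow> ('i \<Rightarrow> 'i \<Rightarrow> 'p \<Rightarrow> 'p \<Rightarrow> bool) \<Rightarrow> ('i \<times> 'i) set \<Rightarrow> ('i \<Rightarrow> 'p) set" where
  "edge_homs V A R E = {f \<in> V \<rightarrow>\<^sub>E A. \<forall>(i,j)\<in>E. R i j (f i) (f j)}"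

text \<open>Real-valued and defined for all functions, so that single coordinates can be changed
  freely, and idempotent, so that the squares in Cauchy-Schwarz turn back into counts.\<close>

definition edge_ind :: "('i \<Rightarrow> 'i \<Rightarrow> 'p \<Rightarrow> 'p \<Rightarrow> bool) \<Rightarrow> ('i \<times> 'i) set \<Rightarrow> ('i \<Rightarrow> 'p) \<Rightarrow> real" where
  "edge_ind R E f = of_bool (\<forall>(i,j)\<in>E. R i j (f i) (f j))"

definition edges_at :: "('i \<times> 'i) set \<Rightarrow> 'i \<Rightarrow> ('i \<times> 'i) set" where
  "edges_at E v = {e \<in> E. fst e = v \<or> snd e = v}"

lemma sum_edge_ind:
  assumes "finite A" "finite V"
  shows "(\<Sum>f\<in>V \<rightarrow>\<^sub>E A. edge_ind R E f) = real (card (edge_homs V A R E))"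
  using assms finite_PiE[of V "\<lambda>_. A"] unfolding edge_ind_def edge_homs_def of_bool_def
  by (simp add: sum.If_cases Int_def)

lemma edge_ind_sq: "(edge_ind R E f)\<^sup>2 = edge_ind R E f"
  by (simp add: edge_ind_def)

lemma edge_ind_nonneg [simp]: "0 \<le> edge_ind R E f"
  by (simp add: edge_ind_def)

lemma edge_ind_Un: "edge_ind R (E \<union> F) f = edge_ind R E f * edge_ind R F f"
  by (simp add: edge_ind_def ball_Un)

lemma edge_ind_update:
  "edge_ind R (E - edges_at E v) (f(v := x)) = edge_ind R (E - edges_at E v) f"
  unfolding edge_ind_def edges_at_def by (intro arg_cong[where f = of_bool] ball_cong) auto

lemma card_minus_edges_at:
  assumes "finite E"
  shows "card E = card (E - edges_at E v) + card (edges_at E v)"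
proof -
  have "edges_at E v \<subseteq> E" by (auto simp: edges_at_def)
  then show ?thesis using assms by (simp add: card_Diff_subset finite_subset card_mono)
qed

context
  fixes V :: "nat set" and A :: "'p set" and R :: "nat \<Rightarrow> nat \<Rightarrow> 'p \<Rightarrow> 'p \<Rightarrow> bool" and q M :: real
  assumes finV: "finite V" and finA: "finite A"
begin

abbreviation "hom_count E \<equiv> real (card (edge_homs V A R E))"

lemma edge_count_step:
  assumes e: "(u, v) \<in> E" "u \<noteq> v" "u \<in> V" "v \<in> V" and nopar: "(v, u) \<notin> E" and M: "0 \<le> M" and A: "A \<noteq> {}"
    and bilin: "\<And>a b. \<bar>\<Sum>x\<in>A. \<Sum>y\<in>A. a x * b y * (q * of_bool (R u v x y) - 1)\<bar>
      \<le> M * (sqrt (\<Sum>x\<in>A. (a x)\<^sup>2) * sqrt (\<Sum>y\<in>A. (b y)\<^sup>2))"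
  shows "\<bar>q * hom_count E - hom_count (E - {(u, v)})\<bar> \<le> M / real (card A) *
    sqrt (hom_count (E - {(u, v)} - edges_at (E - {(u, v)}) v) * hom_count (E - {(u, v)} - edges_at (E - {(u, v)}) u))"
proof -
  define c where "c = real (card A)"
  have c: "c > 0" using A finA by (simp add: c_def card_gt_0_iff)
  define E' where "E' = E - {(u, v)}"
  define \<alpha> where "\<alpha> = edge_ind R (E' - edges_at E' v)"
  define \<beta> where "\<beta> = edge_ind R (E' - edges_at E' u)"
  define D where "D = (\<Sum>f\<in>V \<rightarrow>\<^sub>E A. edge_ind R E' f * (q * of_bool (R u v (f u) (f v)) - 1))"
  have split_E: "edge_ind R E f = edge_ind R E' f * of_bool (R u v (f u) (f v))" for f
    using e(1) by (auto simp: edge_ind_def E'_def)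
  have D: "D = q * hom_count E - hom_count E'"
    unfolding D_def sum_edge_ind[OF finA finV, symmetric] split_E
    by (simp add: sum_distrib_left sum_subtractf algebra_simps)
  have prod: "edge_ind R E' f = \<alpha> f * \<beta> f" for f
  proof -
    \<comment> \<open>Only an edge between \<open>u\<close> and \<open>v\<close> could be missed,
      and neither orientation is left. Edges lying in both parts do no harm, since indicators are
      idempotent.\<close>
    have "E' = (E' - edges_at E' v) \<union> (E' - edges_at E' u)"
      using e(2) nopar by (auto simp: edges_at_def E'_def)
    then show ?thesis unfolding \<alpha>_def \<beta>_def by (metis edge_ind_Un)
  qed
  have upd: "\<alpha> (f(u := x, v := y)) = \<alpha> (f(u := x))" "\<beta> (f(u := x, v := y)) = \<beta> (f(v := y))" for f x y
    using e(2) edge_ind_update[of R E' v "f(u := x)" y] edge_ind_update[of R E' u "f(v := y)" x]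
    by (simp_all add: \<alpha>_def \<beta>_def fun_upd_twist)
  have "c * (c * D) = (\<Sum>f\<in>V \<rightarrow>\<^sub>E A. \<Sum>x\<in>A. \<Sum>y\<in>A.
      edge_ind R E' (f(u := x, v := y)) * (q * of_bool (R u v ((f(u := x, v := y)) u) ((f(u := x, v := y)) v)) - 1))"
    unfolding D_def c_def
    by (subst sum_PiE_update[OF finA e(4) finV, symmetric], subst sum_PiE_update[OF finA e(3) finV, symmetric]) simp
  also have "\<dots> = (\<Sum>f\<in>V \<rightarrow>\<^sub>E A. \<Sum>x\<in>A. \<Sum>y\<in>A. \<alpha> (f(u := x)) * \<beta> (f(v := y)) * (q * of_bool (R u v x y) - 1))"
    using e(2) by (simp add: prod upd)
  finally have "c * (c * D) = \<dots>" .
  then have "\<bar>c * (c * D)\<bar> \<le> (\<Sum>f\<in>V \<rightarrow>\<^sub>E A. M * (sqrt (\<Sum>x\<in>A. (\<alpha> (f(u := x)))\<^sup>2) * sqrt (\<Sum>y\<in>A. (\<beta> (f(v := y)))\<^sup>2)))"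
    by (simp only:) (intro order_trans[OF sum_abs] sum_mono bilin)
  also have "\<dots> = M * (\<Sum>f\<in>V \<rightarrow>\<^sub>E A. \<bar>sqrt (\<Sum>x\<in>A. \<alpha> (f(u := x)))\<bar> * \<bar>sqrt (\<Sum>y\<in>A. \<beta> (f(v := y)))\<bar>)"
    by (simp add: \<alpha>_def \<beta>_def edge_ind_sq sum_distrib_left sum_nonneg)
  also have "\<dots> \<le> M * (L2_set (\<lambda>f. sqrt (\<Sum>x\<in>A. \<alpha> (f(u := x)))) (V \<rightarrow>\<^sub>E A) * L2_set (\<lambda>f. sqrt (\<Sum>y\<in>A. \<beta> (f(v := y)))) (V \<rightarrow>\<^sub>E A))"
    by (intro mult_left_mono L2_set_mult_ineq M)
  also have "L2_set (\<lambda>f. sqrt (\<Sum>x\<in>A. \<alpha> (f(u := x)))) (V \<rightarrow>\<^sub>E A) = sqrt (c * hom_count (E' - edges_at E' v))"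
    unfolding L2_set_def c_def sum_edge_ind[OF finA finV, symmetric] sum_PiE_update[OF finA e(3) finV, symmetric] \<alpha>_def
    by (simp add: sum_nonneg)
  also have "L2_set (\<lambda>f. sqrt (\<Sum>y\<in>A. \<beta> (f(v := y)))) (V \<rightarrow>\<^sub>E A) = sqrt (c * hom_count (E' - edges_at E' u))"
    unfolding L2_set_def c_def sum_edge_ind[OF finA finV, symmetric] sum_PiE_update[OF finA e(4) finV, symmetric] \<beta>_def
    by (simp add: sum_nonneg)
  also have "M * (sqrt (c * hom_count (E' - edges_at E' v)) * sqrt (c * hom_count (E' - edges_at E' u)))
      = c * (M * sqrt (hom_count (E' - edges_at E' v) * hom_count (E' - edges_at E' u)))"
    using c by (simp add: real_sqrt_mult)
  finally have "c * \<bar>D\<bar> \<le> M * sqrt (hom_count (E' - edges_at E' v) * hom_count (E' - edges_at E' u))"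
    using c by (simp add: abs_mult)
  then show ?thesis using c unfolding D E'_def[symmetric] c_def[symmetric]
    by (simp add: field_simps)
qed

text \<open>Once the edges at \<open>v\<close> are dropped, the value at \<open>v\<close> is free,
  and just one of its |A| possible values coincides with that at \<open>u\<close>.\<close>

lemma edge_homs_collision:
  assumes uv: "u \<noteq> v" "v \<in> V" "u \<in> V" and A: "A \<noteq> {}"
  shows "real (card {f \<in> edge_homs V A R E. f u = f v}) \<le> hom_count (E - edges_at E v) / real (card A)"
proof -
  define c where "c = real (card A)"
  have c: "c > 0" using A finA by (simp add: c_def card_gt_0_iff)
  define \<Phi> where "\<Phi> f = edge_ind R (E - edges_at E v) f * of_bool (f u = f v)" for f :: "nat \<Rightarrow> 'p"
  have finO: "finite (V \<rightarrow>\<^sub>E A)" using finV finA by (intro finite_PiE) auto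
  have "real (card {f \<in> edge_homs V A R E. f u = f v}) = (\<Sum>f\<in>{f \<in> edge_homs V A R E. f u = f v}. \<Phi> f)"
    by (simp add: \<Phi>_def edge_ind_def edge_homs_def)
  also have "\<dots> \<le> (\<Sum>f\<in>V \<rightarrow>\<^sub>E A. \<Phi> f)"
    using finO by (intro sum_mono2) (auto simp: edge_homs_def \<Phi>_def edge_ind_def)
  finally have "c * real (card {f \<in> edge_homs V A R E. f u = f v}) \<le> c * (\<Sum>f\<in>V \<rightarrow>\<^sub>E A. \<Phi> f)"
    using c by simp
  also have "\<dots> = (\<Sum>f\<in>V \<rightarrow>\<^sub>E A. \<Sum>y\<in>A. edge_ind R (E - edges_at E v) f * of_bool (f u = y))"
    unfolding c_def sum_PiE_update[OF finA uv(2) finV, symmetric] \<Phi>_def edge_ind_update using uv(1) by simp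
  also have "\<dots> = (\<Sum>f\<in>V \<rightarrow>\<^sub>E A. edge_ind R (E - edges_at E v) f)"
  proof (rule sum.cong)
    fix f assume "f \<in> V \<rightarrow>\<^sub>E A"
    then have "f u \<in> A" using uv(3) by auto
    then show "(\<Sum>y\<in>A. edge_ind R (E - edges_at E v) f * of_bool (f u = y)) = edge_ind R (E - edges_at E v) f"
      using finA by (simp add: of_bool_def sum.delta if_distrib cong: if_cong)
  qed simp
  also have "\<dots> = hom_count (E - edges_at E v)" by (rule sum_edge_ind[OF finA finV])
  finally show ?thesis using c by (simp add: c_def field_simps)
qed

text \<open>The error made when removing an edge involves the counts for the graphs in which one of its ends is
  isolated; the induction hypothesis bounds their normalised counts by 2.\<close>

lemma edge_count_estimate:
  fixes t :: nat
  assumes q: "q \<ge> 1" and M: "0 \<le> M" and A: "A \<noteq> {}"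
    and EV: "E0 \<subseteq> {(i, j). i < j \<and> i \<in> V \<and> j \<in> V}"
    and deg: "\<And>v. card (edges_at E0 v) \<le> t"
    and bilin: "\<And>u v a b. (u, v) \<in> E0 \<Longrightarrow> \<bar>\<Sum>x\<in>A. \<Sum>y\<in>A. a x * b y * (q * of_bool (R u v x y) - 1)\<bar>
      \<le> M * (sqrt (\<Sum>x\<in>A. (a x)\<^sup>2) * sqrt (\<Sum>y\<in>A. (b y)\<^sup>2))"
    and \<delta>: "2 * M * q ^ t \<le> \<delta> * (q * real (card A))" "real (card E0) * \<delta> \<le> 1"
    and E: "E \<subseteq> E0"
  shows "\<bar>hom_count E * q ^ card E / real (card A) ^ card V - 1\<bar> \<le> real (card E) * \<delta>"
  using E
proof (induction "card E" arbitrary: E rule: less_induct)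
  case less
  define c where "c = real (card A)"
  have c: "c > 0" using A finA by (simp add: c_def card_gt_0_iff)
  define r where "r E = hom_count E * q ^ card E / c ^ card V" for E
  have finE0: "finite E0" by (rule finite_subset[OF EV], rule finite_subset[of _ "V \<times> V"]) (use finV in auto)
  have finE: "finite E" using less.prems finE0 finite_subset by blast
  show ?case
  proof (cases "E = {}")
    case True
    have "hom_count {} = c ^ card V"
      unfolding edge_homs_def c_def using finV by (simp add: card_PiE)
    then show ?thesis using c True by (simp add: c_def[symmetric])
  next
    case False
    then obtain u v where uvE: "(u, v) \<in> E" by auto
    then have uv: "u < v" "u \<in> V" "v \<in> V" "(u, v) \<in> E0" using EV less.prems by auto
    have vu: "(v, u) \<notin> E" using EV less.prems uv(1) by auto
    define E' where "E' = E - {(u, v)}"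
    have cardE: "card E = Suc (card E')" unfolding E'_def by (rule card.remove[OF finE uvE])
    have E'E0: "E' \<subseteq> E0" using less.prems by (auto simp: E'_def)
    have finE': "finite E'" using finE by (simp add: E'_def)
    have \<delta>0: "\<delta> \<ge> 0"
    proof -
      have "0 \<le> 2 * M * q ^ t" using M q by simp
      then have "0 \<le> \<delta> * (q * c)" using \<delta>(1) by (simp add: c_def)
      moreover have "q * c > 0" using c q by simp
      ultimately show ?thesis by (metis mult_neg_pos not_le)
    qed
    \<comment> \<open>The total error allowed is at most 1, so the normalised count of any subgraph
      of \<open>E'\<close> is at most 2.\<close>
    have bd: "hom_count F \<le> 2 * c ^ card V / q ^ card F" if "F \<subseteq> E'" for F
    proof -
      have "card F \<le> card E'" using that finE' by (rule card_mono[rotated])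
      then have "card F < card E" using cardE by simp
      moreover have "F \<subseteq> E0" using that E'E0 by simp
      ultimately have "\<bar>r F - 1\<bar> \<le> real (card F) * \<delta>" using less.hyps by (simp add: r_def c_def)
      also have "\<dots> \<le> real (card E0) * \<delta>"
        using \<delta>0 card_mono[OF finE0 \<open>F \<subseteq> E0\<close>] by (intro mult_right_mono) auto
      finally have "r F \<le> 2" using \<delta>(2) by linarith
      then show ?thesis using c q by (simp add: r_def field_simps)
    qed
    \<comment> \<open>The removed edge uses up one unit of the degree at both its ends, which gains
      a factor \<open>q\<close> over \<open>q ^ t\<close>.\<close>
    have degE': "card (edges_at E' w) + 1 \<le> t" if "w = u \<or> w = v" for w
    proof -
      have "insert (u, v) (edges_at E' w) \<subseteq> edges_at E0 w"
        using that uv(4) E'E0 by (auto simp: edges_at_def)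
      moreover have "finite (edges_at E0 w)" "finite (edges_at E' w)"
        using finE0 finE' by (auto simp: edges_at_def)
      ultimately have "card (insert (u, v) (edges_at E' w)) \<le> t"
        using deg[of w] card_mono order_trans by metis
      moreover have "(u, v) \<notin> edges_at E' w" by (auto simp: edges_at_def E'_def)
      ultimately show ?thesis using \<open>finite (edges_at E' w)\<close> by simp
    qed
    have Nw: "hom_count (E' - edges_at E' w) \<le> 2 * c ^ card V * q ^ (t - 1) / q ^ card E'" if "w = u \<or> w = v" for w
    proof -
      have "hom_count (E' - edges_at E' w) \<le> 2 * c ^ card V / q ^ card (E' - edges_at E' w)" by (rule bd) auto
      also have "\<dots> \<le> 2 * c ^ card V * q ^ (t - 1) / q ^ card E'"
      proof -
        have "q ^ card E' = q ^ card (E' - edges_at E' w) * q ^ card (edges_at E' w)"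
          using card_minus_edges_at[OF finE', of w] by (simp add: power_add)
        moreover have "q ^ card (edges_at E' w) \<le> q ^ (t - 1)"
          using degE'[OF that] q by (intro power_increasing) auto
        ultimately show ?thesis using q c
          by (simp add: field_simps mult_left_mono)
      qed
      finally show ?thesis .
    qed
    define B where "B = 2 * c ^ card V * q ^ (t - 1) / q ^ card E'"
    have B: "B \<ge> 0" using c q by (simp add: B_def)
    have "\<bar>q * hom_count E - hom_count E'\<bar> \<le> M / c * sqrt (hom_count (E' - edges_at E' v) * hom_count (E' - edges_at E' u))"
      using edge_count_step[OF uvE _ uv(2,3) vu M A bilin[OF uv(4)]] uv(1)
      unfolding E'_def[symmetric] c_def[symmetric] by blast
    also have "\<dots> \<le> M / c * sqrt (B * B)"
      using Nw B M c by (intro mult_left_mono real_sqrt_le_mono mult_mono) (auto simp: B_def)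
    also have "sqrt (B * B) = B" using B by simp
    finally have "\<bar>q * hom_count E - hom_count E'\<bar> \<le> M / c * B" .
    then have "\<bar>q * hom_count E - hom_count E'\<bar> * (q ^ card E' / c ^ card V) \<le> M / c * B * (q ^ card E' / c ^ card V)"
      using q c by (intro mult_right_mono) auto
    also have "M / c * B * (q ^ card E' / c ^ card V) = 2 * M * q ^ (t - 1) / c"
      using q c by (simp add: B_def)
    also have "\<dots> \<le> \<delta>"
    proof -
      have "t \<ge> 1" using degE'[of u] by simp
      then have "q ^ t = q * q ^ (t - 1)" by (cases t) auto
      then have "q * (2 * M * q ^ (t - 1)) \<le> q * (\<delta> * c)"
        using \<delta>(1) by (simp only: c_def ac_simps)
      then have "2 * M * q ^ (t - 1) \<le> \<delta> * c" using q by (simp only: mult_le_cancel_left_pos)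
      then show ?thesis using c by (simp add: divide_le_eq)
    qed
    also have "\<bar>q * hom_count E - hom_count E'\<bar> * (q ^ card E' / c ^ card V) = \<bar>r E - r E'\<bar>"
    proof -
      have "r E - r E' = (q * hom_count E - hom_count E') * (q ^ card E' / c ^ card V)"
        by (simp add: r_def cardE diff_divide_distrib algebra_simps)
      moreover have "q ^ card E' / c ^ card V \<ge> 0" using q c by simp
      ultimately show ?thesis by (simp only: abs_mult abs_of_nonneg)
    qed
    finally have "\<bar>r E - r E'\<bar> \<le> \<delta>" .
    moreover have "\<bar>r E' - 1\<bar> \<le> real (card E') * \<delta>"
      using less.hyps[of E'] E'E0 cardE by (simp add: r_def c_def)
    ultimately have "\<bar>r E - 1\<bar> \<le> real (card E') * \<delta> + \<delta>" by linarith
    then show ?thesis by (simp add: r_def c_def cardE algebra_simps)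
  qed
qed

end

lemma card_injective_homs_ge:
  fixes A :: "'p set" and R :: "nat \<Rightarrow> nat \<Rightarrow> 'p \<Rightarrow> 'p \<Rightarrow> bool" and q M :: real and n t :: nat
  assumes n: "n > 0" and finA: "finite A" and A: "A \<noteq> {}" and q: "q \<ge> 1" and M: "2 * q \<le> M"
    and E: "E \<subseteq> {(i, j). i < j \<and> j < n}" and deg: "\<And>v. card (edges_at E v) \<le> t"
    and bilin: "\<And>u v a b. (u, v) \<in> E \<Longrightarrow> \<bar>\<Sum>x\<in>A. \<Sum>y\<in>A. a x * b y * (q * of_bool (R u v x y) - 1)\<bar>
      \<le> M * (sqrt (\<Sum>x\<in>A. (a x)\<^sup>2) * sqrt (\<Sum>y\<in>A. (b y)\<^sup>2))"
    and dens: "6 * (real n)\<^sup>2 * q ^ t * M \<le> q * real (card A)"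
  shows "real (card {f \<in> edge_homs {..<n} A R E. inj_on f {..<n}}) \<ge> 1 / 2 * real (card A) ^ n / q ^ card E"
proof -
  define c where "c = real (card A)"
  have c: "c > 0" using A finA by (simp add: c_def card_gt_0_iff)
  \<comment> \<open>This is the error per edge that \<open>dens\<close> permits; with at most n^2/2
    edges the errors sum to at most 1/6.\<close>
  define \<delta> where "\<delta> = 1 / (3 * (real n)\<^sup>2)"
  define m where "m = card E"
  have finE: "finite E" by (rule finite_subset[OF E], rule finite_subset[of _ "{..<n} \<times> {..<n}"]) auto
  have EV: "E \<subseteq> {(i, j). i < j \<and> i \<in> {..<n} \<and> j \<in> {..<n}}" using E by auto
  \<comment> \<open>Each edge is stored with its smaller end first, so \<open>E\<close> and its
    converse are disjoint sets of pairs of vertices.\<close>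
  have "2 * m \<le> n * n"
  proof -
    have less: "i < j" if "(i, j) \<in> E" for i j using E that by auto
    then have "E \<inter> E\<inverse> = {}" by (auto dest: less less_asym[OF less])
    then have "card (E \<union> E\<inverse>) = card E + card (E\<inverse>)"
      using finE by (intro card_Un_disjoint) auto
    then have "2 * m = card (E \<union> E\<inverse>)" by (simp add: m_def)
    also have "\<dots> \<le> card ({..<n} \<times> {..<n})" using E by (intro card_mono) auto
    finally show ?thesis by (simp add: card_cartesian_product)
  qed
  then have "real (2 * m) \<le> real (n * n)" by (rule of_nat_mono)
  then have m\<delta>: "real m * \<delta> \<le> 1 / 6"
    using n by (simp add: \<delta>_def power2_eq_square field_simps)
  have \<delta>: "2 * M * q ^ t \<le> \<delta> * (q * real (card A))"
    using dens n by (simp add: \<delta>_def field_simps)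
  have est: "\<bar>real (card (edge_homs {..<n} A R F)) * q ^ card F / c ^ n - 1\<bar> \<le> 1 / 6" if "F \<subseteq> E" for F
  proof -
    have "\<bar>real (card (edge_homs {..<n} A R F)) * q ^ card F / c ^ n - 1\<bar> \<le> real (card F) * \<delta>"
      using edge_count_estimate[OF _ finA q _ A EV deg bilin \<delta> _ that] M q m\<delta>
      by (simp add: c_def m_def)
    also have "\<dots> \<le> real m * \<delta>"
      using card_mono[OF finE that] by (intro mult_right_mono) (auto simp: m_def \<delta>_def)
    finally show ?thesis using m\<delta> by linarith
  qed
  have qp: "q ^ k > 0" for k using q by simp
  have lower: "5 / 6 * c ^ n / q ^ m \<le> real (card (edge_homs {..<n} A R E))"
  proof -
    have "5 / 6 \<le> real (card (edge_homs {..<n} A R E)) * q ^ m / c ^ n"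
      using abs_le_D2[OF est[of E]] unfolding m_def by auto
    then show ?thesis using c qp[of m] by (simp add: field_simps)
  qed
  \<comment> \<open>\<open>M\<close> \<ge> 2 \<open>q\<close> turns the density assumption into a
    bound on |A| itself. This makes coincidences rare: dropping the edges at \<open>v\<close> costs
    a factor of at most \<open>q ^ t\<close>, and the coincidence gains 1/|A|.\<close>
  have cbound: "12 * (real n)\<^sup>2 * q ^ t \<le> c"
  proof -
    have "q * (12 * (real n)\<^sup>2 * q ^ t) = 6 * (real n)\<^sup>2 * q ^ t * (2 * q)" by simp
    also have "\<dots> \<le> 6 * (real n)\<^sup>2 * q ^ t * M" using M q by (intro mult_left_mono) auto
    also have "\<dots> \<le> q * c" using dens by (simp add: c_def)
    finally show ?thesis using q by (simp only: mult_le_cancel_left_pos)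
  qed
  have coll: "real (card {f \<in> edge_homs {..<n} A R E. f u = f v}) \<le> c ^ n / q ^ m / (6 * (real n)\<^sup>2)"
    if uv: "u < n" "v < n" "u \<noteq> v" for u v
  proof -
    have "real (card (edge_homs {..<n} A R (E - edges_at E v))) * q ^ card (E - edges_at E v) / c ^ n \<le> 2"
      using abs_le_D1[OF est[of "E - edges_at E v", OF Diff_subset]] by linarith
    then have "real (card (edge_homs {..<n} A R (E - edges_at E v))) * q ^ card (E - edges_at E v) \<le> 2 * c ^ n"
      using c by (simp add: divide_le_eq)
    then have "real (card (edge_homs {..<n} A R (E - edges_at E v))) * q ^ card (E - edges_at E v) * q ^ card (edges_at E v)
        \<le> 2 * c ^ n * q ^ t"
      by (rule mult_mono) (use deg[of v] q c in \<open>auto intro: power_increasing\<close>)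
    then have "real (card (edge_homs {..<n} A R (E - edges_at E v))) * q ^ m \<le> 2 * c ^ n * q ^ t"
      using card_minus_edges_at[OF finE, of v] by (simp add: m_def power_add)
    then have N: "real (card (edge_homs {..<n} A R (E - edges_at E v))) \<le> 2 * c ^ n * q ^ t / q ^ m"
      using qp[of m] by (simp add: field_simps)
    have "real (card {f \<in> edge_homs {..<n} A R E. f u = f v}) \<le> real (card (edge_homs {..<n} A R (E - edges_at E v))) / c"
      unfolding c_def using uv by (intro edge_homs_collision finA A) auto
    also have "\<dots> \<le> (2 * c ^ n * q ^ t / q ^ m) / c" using N c by (intro divide_right_mono) auto
    also have "\<dots> = c ^ n / q ^ m * (2 * q ^ t / c)" by simp
    also have "\<dots> \<le> c ^ n / q ^ m * (1 / (6 * (real n)\<^sup>2))"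
      using cbound c n qp[of m] by (intro mult_left_mono) (auto simp: field_simps)
    finally show ?thesis by simp
  qed
  define H where "H = {f \<in> edge_homs {..<n} A R E. inj_on f {..<n}}"
  define C where "C = (\<lambda>(u, v). {f \<in> edge_homs {..<n} A R E. f u = f v})"
  define D where "D = {(u, v). u < n \<and> v < n \<and> u \<noteq> v}"
  have finH: "finite (edge_homs {..<n} A R E)"
    unfolding edge_homs_def using finA finite_PiE[of "{..<n}" "\<lambda>_. A"] by simp
  have D: "finite D" "card D \<le> n * n"
  proof -
    have sub: "D \<subseteq> {..<n} \<times> {..<n}" by (auto simp: D_def)
    show "finite D" by (rule finite_subset[OF sub]) simp
    show "card D \<le> n * n" using card_mono[OF _ sub] by (simp add: card_cartesian_product)
  qed
  have "edge_homs {..<n} A R E \<subseteq> H \<union> (\<Union>z\<in>D. C z)"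
    by (auto simp: H_def C_def D_def inj_on_def)
  then have "card (edge_homs {..<n} A R E) \<le> card (H \<union> (\<Union>z\<in>D. C z))"
    using finH D by (intro card_mono) (auto simp: H_def C_def)
  also have "\<dots> \<le> card H + (\<Sum>z\<in>D. card (C z))"
    by (rule order_trans[OF card_Un_le add_left_mono[OF card_UN_le[OF D(1)]]])
  finally have "real (card (edge_homs {..<n} A R E)) \<le> real (card H + (\<Sum>z\<in>D. card (C z)))"
    by (rule of_nat_mono)
  also have "\<dots> = real (card H) + (\<Sum>z\<in>D. real (card (C z)))" by simp
  also have "(\<Sum>z\<in>D. real (card (C z))) \<le> (\<Sum>z\<in>D. c ^ n / q ^ m / (6 * (real n)\<^sup>2))"
    using coll by (intro sum_mono) (auto simp: C_def D_def)
  also have "\<dots> = real (card D) * (c ^ n / q ^ m / (6 * (real n)\<^sup>2))" by simp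
  also have "\<dots> \<le> real (n * n) * (c ^ n / q ^ m / (6 * (real n)\<^sup>2))"
    using D(2) c qp[of m] by (intro mult_right_mono of_nat_mono) auto
  also have "\<dots> = 1 / 6 * c ^ n / q ^ m" using n by (simp add: power2_eq_square)
  finally have "5 / 6 * c ^ n / q ^ m \<le> real (card H) + 1 / 6 * c ^ n / q ^ m" using lower by linarith
  moreover have "c ^ n / q ^ m \<ge> 0" using c qp[of m] by simp
  ultimately show ?thesis by (simp add: H_def c_def m_def)
qed

section \<open>Distance graphs over a finite field\<close>

lemma sqnorm_minus_commute: "sqnorm (x - y) = sqnorm (y - x)"
  by (simp add: sqnorm_def power2_commute)

theorem theorem5p2:
  fixes A :: "('a::{field,finite} ^ 'd) set"
    and n t :: nat
    and adj :: "nat \<Rightarrow> nat \<Rightarrow> bool"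
    and lam :: "nat \<Rightarrow> nat \<Rightarrow> 'a"
  assumes odd_q: "odd CARD('a)"
    and adj_dom: "\<And>i j. adj i j \<Longrightarrow> i < n \<and> j < n"
    and adj_sym: "\<And>i j. adj i j \<Longrightarrow> adj j i"
    and adj_irrefl: "\<And>i. \<not> adj i i"
    and lam_sym: "\<And>i j. adj i j \<Longrightarrow> lam i j = lam j i"
    and lam_nz: "\<And>i j. adj i j \<Longrightarrow> lam i j \<noteq> 0"
    and deg_le: "\<And>i. i < n \<Longrightarrow> gdeg n adj i \<le> t"
    and deg_max: "n > 0 \<Longrightarrow> (\<exists>i<n. gdeg n adj i = t)"
    and dens: "real (card A) / real CARD('a) ^ CARD('d)
               \<ge> 12 * real n ^ 2 * real CARD('a) powr (real t - (real CARD('d) + 1) / 2)"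
  shows "real (card {xs. length xs = n \<and> distinct xs \<and> set xs \<subseteq> A \<and>
                 (\<forall>i j. adj i j \<longrightarrow> sqnorm (xs ! i - xs ! j) = lam i j)})
         \<ge> (1/2) * real (card A) ^ n * real CARD('a) powr (- real (card (gedges n adj)))"
proof -
  define q where "q = real CARD('a)"
  define d where "d = CARD('d)"
  define L where "L = {xs. length xs = n \<and> distinct xs \<and> set xs \<subseteq> A \<and>
                 (\<forall>i j. adj i j \<longrightarrow> sqnorm (xs ! i - xs ! j) = lam i j)}"
  define E where "E = {(i, j). i < j \<and> adj i j}"
  define R where "R i j x y \<longleftrightarrow> sqnorm (x - y) = lam i j" for i j and x y :: "'a ^ 'd"
  have q1: "q > 1" using card_field_ge_2[where 'a = 'a] by (simp add: q_def)
  have edges: "card (gedges n adj) = card E"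
  proof -
    have "gedges n adj = (\<lambda>(i, j). {i, j}) ` E"
    proof (intro equalityI subsetI)
      fix e assume "e \<in> gedges n adj"
      then obtain i j where ij: "e = {i, j}" "adj i j" by (auto simp: gedges_def)
      then consider "i < j" | "j < i" using adj_irrefl by (metis linorder_neqE_nat)
      then show "e \<in> (\<lambda>(i, j). {i, j}) ` E"
      proof cases
        case 1
        then show ?thesis using ij by (intro image_eqI[of _ _ "(i, j)"]) (auto simp: E_def)
      next
        case 2
        then show ?thesis using ij adj_sym[OF ij(2)] by (intro image_eqI[of _ _ "(j, i)"]) (auto simp: E_def)
      qed
    qed (use adj_dom in \<open>auto simp: gedges_def E_def\<close>)
    moreover have "inj_on (\<lambda>(i, j). {i, j}) E" by (auto simp: inj_on_def E_def doubleton_eq_iff)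
    ultimately show ?thesis by (simp add: card_image)
  qed
  have powr_m: "q powr (- real (card E)) = 1 / q ^ card E"
    using q1 by (simp add: powr_minus_divide powr_realpow)
  show ?thesis
  proof (cases "n = 0")
    \<comment> \<open>Without vertices there is only the empty tuple, and the claim is 1/2 \<le>
      1.\<close>
    case True
    have "E = {}" using adj_dom True by (auto simp: E_def)
    moreover have "L = {[]}" using True adj_dom by (auto simp: L_def)
    ultimately show ?thesis
      unfolding edges L_def[symmetric] using True by simp
  next
    case False
    then have n: "n > 0" by simp
    \<comment> \<open>Half-integral powers of q become natural powers of \<open>s\<close>.\<close>
    define s where "s = sqrt q"
    have s: "s > 0" "s ^ 2 = q" using q1 by (auto simp: s_def)
    have "s \<ge> 1" using q1 by (simp add: s_def)
    have "d \<ge> 1" by (simp add: d_def Suc_leI)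
    have spow: "q powr ((real d + 1) / 2) = s ^ (d + 1)"
    proof -
      have "s ^ (d + 1) = s powr real (d + 1)" using s by (intro powr_realpow[symmetric])
      also have "\<dots> = (q powr (1 / 2)) powr real (d + 1)" using q1 by (simp add: s_def powr_half_sqrt)
      also have "\<dots> = q powr (1 / 2 * real (d + 1))" by (rule powr_powr)
      finally show ?thesis by (simp add: algebra_simps)
    qed
    have c: "12 * (real n)\<^sup>2 * (q ^ t / s ^ (d + 1)) * q ^ d \<le> real (card A)"
      using dens q1 unfolding q_def[symmetric] d_def[symmetric] powr_diff spow
      by (simp add: powr_realpow pos_le_divide_eq)
    have qs: "q * q ^ d = s ^ (d + 1) * s ^ (d + 1)"
      by (simp add: s(2)[symmetric] power_mult_distrib[symmetric] power2_eq_square)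
    \<comment> \<open>12 is 6 times the factor 2 in the operator norm 2 s^(d+1); the exponents match
      because q^(d+1) is the square of s^(d+1).\<close>
    have dens': "6 * (real n)\<^sup>2 * q ^ t * (2 * s ^ (d + 1)) \<le> q * real (card A)"
    proof -
      have "6 * (real n)\<^sup>2 * q ^ t * (2 * s ^ (d + 1)) = 12 * (real n)\<^sup>2 * (q ^ t / s ^ (d + 1)) * (q * q ^ d)"
        unfolding qs using s by simp
      also have "\<dots> = q * (12 * (real n)\<^sup>2 * (q ^ t / s ^ (d + 1)) * q ^ d)" by simp
      also have "\<dots> \<le> q * real (card A)" using c q1 by (intro mult_left_mono) auto
      finally show ?thesis .
    qed
    have "A \<noteq> {}"
    proof
      assume "A = {}"
      moreover have "6 * (real n)\<^sup>2 * q ^ t * (2 * s ^ (d + 1)) > 0" using n q1 s by simp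
      ultimately show False using dens' by simp
    qed
    \<comment> \<open>Here d \<ge> 1 enters: the operator norm has to dominate 2 q for the bound on
      coincidences.\<close>
    have "q \<le> s ^ (d + 1)"
      using power_increasing[of 2 "d + 1" s] \<open>s \<ge> 1\<close> \<open>d \<ge> 1\<close> s(2) by simp
    then have M: "2 * q \<le> 2 * s ^ (d + 1)" by simp
    have deg: "card (edges_at E v) \<le> t" for v
    proof (cases "v < n")
      case True
      have "card (edges_at E v) \<le> card {j. j < n \<and> adj v j}"
      proof (rule card_inj_on_le)
        \<comment> \<open>An edge at \<open>v\<close> is recovered from its other end, because its
          orientation is fixed by the order of the vertices.\<close>
        show "inj_on (\<lambda>e. if fst e = v then snd e else fst e) (edges_at E v)"
          by (auto simp: inj_on_def edges_at_def E_def)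
        show "(\<lambda>e. if fst e = v then snd e else fst e) ` edges_at E v \<subseteq> {j. j < n \<and> adj v j}"
          using adj_dom adj_sym by (auto simp: edges_at_def E_def)
      qed simp
      then show ?thesis using deg_le[OF True] by (simp add: gdeg_def)
    next
      case False
      then have "edges_at E v = {}" using adj_dom by (auto simp: edges_at_def E_def)
      then show ?thesis by simp
    qed
    have "1 / 2 * real (card A) ^ n / q ^ card E
        \<le> real (card {f \<in> edge_homs {..<n} A R E. inj_on f {..<n}})"
    proof (rule card_injective_homs_ge[OF n _ \<open>A \<noteq> {}\<close> _ M _ deg _ dens'])
      show "\<bar>\<Sum>x\<in>A. \<Sum>y\<in>A. a x * b y * (q * of_bool (R u v x y) - 1)\<bar>
          \<le> 2 * s ^ (d + 1) * (sqrt (\<Sum>x\<in>A. (a x)\<^sup>2) * sqrt (\<Sum>y\<in>A. (b y)\<^sup>2))"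
        if "(u, v) \<in> E" for u v a b
        using sphere_bilinear_bound[OF odd_q lam_nz[of u v], of a b A] that
        by (simp only: E_def R_def q_def s_def d_def mem_Collect_eq prod.case)
    qed (use q1 adj_dom in \<open>auto simp: E_def\<close>)
    \<comment> \<open>Only a lower bound is claimed, so an injection into the set of tuples is
      enough.\<close>
    also have "card {f \<in> edge_homs {..<n} A R E. inj_on f {..<n}} \<le> card L"
    proof (rule card_inj_on_le)
      show "finite L"
        by (rule finite_subset[OF _ finite_lists_length_eq[of A n]]) (auto simp: L_def)
      show "inj_on (\<lambda>f. map f [0..<n]) {f \<in> edge_homs {..<n} A R E. inj_on f {..<n}}"
      proof (rule inj_onI)
        fix f g assume "f \<in> {f \<in> edge_homs {..<n} A R E. inj_on f {..<n}}"
          "g \<in> {f \<in> edge_homs {..<n} A R E. inj_on f {..<n}}" "map f [0..<n] = map g [0..<n]"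
        then show "f = g" by (intro PiE_ext[of f "{..<n}" "\<lambda>_. A" g]) (auto simp: edge_homs_def)
      qed
      show "(\<lambda>f. map f [0..<n]) ` {f \<in> edge_homs {..<n} A R E. inj_on f {..<n}} \<subseteq> L"
      proof (rule image_subsetI)
        fix f assume f: "f \<in> {f \<in> edge_homs {..<n} A R E. inj_on f {..<n}}"
        have hom: "sqnorm (f i - f j) = lam i j" if "i < j" "adj i j" for i j
          using f that by (auto simp: edge_homs_def E_def R_def)
        have "sqnorm (f i - f j) = lam i j" if adj: "adj i j" for i j
        proof -
          have "i \<noteq> j" using adj_irrefl adj by blast
          then consider "i < j" | "j < i" by linarith
          then show ?thesis
          proof cases
            case 2
            then have "sqnorm (f j - f i) = lam j i" using hom adj_sym[OF adj] by blast
            then show ?thesis using lam_sym[OF adj] sqnorm_minus_commute by metis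
          qed (use hom adj in blast)
        qed
        then show "map f [0..<n] \<in> L"
          using f adj_dom by (auto simp: L_def edge_homs_def distinct_map lessThan_atLeast0)
      qed
    qed
    finally show ?thesis
      unfolding edges L_def[symmetric] q_def[symmetric] powr_m by simp
  qed
qed

end
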